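(* Let $C$ be a finite-dimensional (possibly graded) complex vector space with a differential $d$ given by a matrix with entries in $\mathbb C[k]=\mathbb C[k_1,\dots,k_m]$, let $Q\in\mathbb C[k]$ be irreducible with $\mathfrak h_k\ne0\Rightarrow Q(k)=0$, and let $q$ be a regular homology point. Then there exist matrices $h,i,p,d',h'$ with entries in $\mathbb C(k)$ whose denominators do not vanish at $q$ such that over $\mathbb C(k)$: (i) $h^2=0$, $hdh=h$, $ip=1-dh-hd$, $pi=1$, and $dhd=d$ holds at $q$; (ii) $pdi=Qd'$, $(d')^2=(h')^2=0$, $h'd'+d'h'=1$. Furthermore $H=h+\frac1Q\,ih'p$ satisfies $H^2=0$ and $Hd+dH=1$. The values of $h,i,p$ at $q$ can be chosen freely subject to (i) at $q$. If $C$ is graded, all of this can be made compatible with the grading.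
   Context: $\mathfrak h_k$ denotes the homology of $C$ with the differential evaluated at $k\in\mathbb C^m$. A point $q\in\mathbb C^m$ is a regular homology point if: $Q(q)=0$ and $q$ is a smooth point of the variety $Q=0$; $\dim\mathfrak h_k=\dim\mathfrak h_q$ for all $k$ with $Q(k)=0$ in a Zariski neighborhood of $q$; and there exists $\xi\in T_q\mathbb C^m$ such that, writing a dot for the derivative along $\xi$ at $q$, $\dot Q\ne0$ and the differential on $\mathfrak h_q$ induced by $\dot d$ (well defined since $\dot dd+d\dot d=0$ and a differential since $2\dot d^2+\ddot dd+d\ddot d=0$) is exact. *)

theory Defs
  imports "HOL-Library.Poly_Mapping"
          "HOL-Computational_Algebra.Fraction_Field"
          "HOL-Computational_Algebra.Factorial_Ring"
          "Jordan_Normal_Form.Matrix_Kernel"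
          "Jordan_Normal_Form.DL_Rank"
begin

section \<open>Polynomials in the variables k_v (v ranging over a finite type 'v, m = CARD('v))\<close>

type_synonym 'v mpoly = "(('v, nat) poly_mapping, complex) poly_mapping"

definition mpeval :: "'v mpoly \<Rightarrow> ('v \<Rightarrow> complex) \<Rightarrow> complex" where
  "mpeval p k = (\<Sum>a\<in>Poly_Mapping.keys p. Poly_Mapping.lookup p a * (\<Prod>v\<in>Poly_Mapping.keys (a::('v, nat) poly_mapping). k v ^ Poly_Mapping.lookup a v))"

definition mpdir :: "'v mpoly \<Rightarrow> ('v \<Rightarrow> complex) \<Rightarrow> ('v \<Rightarrow> complex) \<Rightarrow> complex" where
  "mpdir p q xi = (THE c. ((\<lambda>t. mpeval p (\<lambda>v. q v + t * xi v)) has_field_derivative c) (at 0))"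

definition zariski_open :: "('v \<Rightarrow> complex) set \<Rightarrow> bool" where
  "zariski_open U \<longleftrightarrow> (\<exists>F :: 'v mpoly set. U = {k. \<exists>f\<in>F. mpeval f k \<noteq> 0})"

text \<open>Smooth point of the hypersurface Q = 0 (Jacobian criterion: nonzero differential).\<close>
definition smooth_point :: "'v mpoly \<Rightarrow> ('v \<Rightarrow> complex) \<Rightarrow> bool" where
  "smooth_point Q q \<longleftrightarrow> mpeval Q q = 0 \<and> (\<exists>xi. mpdir Q q xi \<noteq> 0)"

definition eval_mat :: "'v mpoly mat \<Rightarrow> ('v \<Rightarrow> complex) \<Rightarrow> complex mat" where
  "eval_mat d k = map_mat (\<lambda>p. mpeval p k) d"

definition dir_mat :: "'v mpoly mat \<Rightarrow> ('v \<Rightarrow> complex) \<Rightarrow> ('v \<Rightarrow> complex) \<Rightarrow> complex mat" where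
  "dir_mat d q xi = map_mat (\<lambda>p. mpdir p q xi) d"

definition hom_dim :: "complex mat \<Rightarrow> nat" where
  "hom_dim D = kernel_dim D - vec_space.rank (dim_row D) D"

text \<open>Exactness of the differential induced by D' on the homology ker D / im D,
  expressed on representatives: im(delta) = ker(delta).\<close>
definition induced_exact :: "complex mat \<Rightarrow> complex mat \<Rightarrow> bool" where
  "induced_exact D D' \<longleftrightarrow> (let n = dim_row D;
      bd = (\<lambda>x. \<exists>y\<in>carrier_vec n. x = D *\<^sub>v y) in
    (\<forall>x\<in>carrier_vec n. D *\<^sub>v x = 0\<^sub>v n \<and> bd (D' *\<^sub>v x) \<longrightarrow>
        (\<exists>y\<in>carrier_vec n. D *\<^sub>v y = 0\<^sub>v n \<and> bd (x - D' *\<^sub>v y))) \<and>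
    (\<forall>y\<in>carrier_vec n. D *\<^sub>v y = 0\<^sub>v n \<longrightarrow> bd (D' *\<^sub>v (D' *\<^sub>v y))))"

definition regular_homology_point ::
  "'v mpoly \<Rightarrow> 'v mpoly mat \<Rightarrow> ('v \<Rightarrow> complex) \<Rightarrow> bool" where
  "regular_homology_point Q d q \<longleftrightarrow>
     mpeval Q q = 0 \<and> smooth_point Q q \<and>
     (\<exists>U. zariski_open U \<and> q \<in> U \<and>
        (\<forall>k\<in>U. mpeval Q k = 0 \<longrightarrow> hom_dim (eval_mat d k) = hom_dim (eval_mat d q))) \<and>
     (\<exists>xi. mpdir Q q xi \<noteq> 0 \<and> induced_exact (eval_mat d q) (dir_mat d q xi))"

type_synonym 'v rfun = "'v mpoly fract"

definition rf :: "('v::linorder) mpoly \<Rightarrow> 'v rfun" where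
  "rf p = Fract p 1"

definition rval :: "(('v::linorder) \<Rightarrow> complex) \<Rightarrow> 'v rfun \<Rightarrow> complex \<Rightarrow> bool" where
  "rval q r c \<longleftrightarrow> (\<exists>a b. r = Fract a b \<and> mpeval b q \<noteq> 0 \<and> c = mpeval a q / mpeval b q)"

definition mat_regular_at :: "(('v::linorder) \<Rightarrow> complex) \<Rightarrow> 'v rfun mat \<Rightarrow> bool" where
  "mat_regular_at q M \<longleftrightarrow>
     (\<forall>a<dim_row M. \<forall>b<dim_col M. \<exists>c. rval q (M $$ (a, b)) c)"

definition mat_val_at :: "(('v::linorder) \<Rightarrow> complex) \<Rightarrow> 'v rfun mat \<Rightarrow> complex mat \<Rightarrow> bool" where
  "mat_val_at q M M0 \<longleftrightarrow> M0 \<in> carrier_mat (dim_row M) (dim_col M) \<and>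
     (\<forall>a<dim_row M. \<forall>b<dim_col M. rval q (M $$ (a, b)) (M0 $$ (a, b)))"

definition homog :: "(nat \<Rightarrow> int) \<Rightarrow> (nat \<Rightarrow> int) \<Rightarrow> int \<Rightarrow> 'a::zero mat \<Rightarrow> bool" where
  "homog degT degS e M \<longleftrightarrow>
     (\<forall>a<dim_row M. \<forall>b<dim_col M. M $$ (a, b) \<noteq> 0 \<longrightarrow> degT a = degS b + e)"

text \<open>Optional grading of C: None = ungraded; Some degC = basis vector j of C lies in degree degC j.
  degH is a grading of (a basis of) the homology h_q.\<close>
definition graded_hip :: "(nat \<Rightarrow> int) option \<Rightarrow> (nat \<Rightarrow> int) \<Rightarrow>
    'a::zero mat \<Rightarrow> 'a mat \<Rightarrow> 'a mat \<Rightarrow> bool" where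
  "graded_hip gr degH h i p \<longleftrightarrow> (case gr of None \<Rightarrow> True | Some degC \<Rightarrow>
     homog degC degC (-1) h \<and> homog degC degH 0 i \<and> homog degH degC 0 p)"

definition graded_ok :: "(nat \<Rightarrow> int) option \<Rightarrow> (nat \<Rightarrow> int) \<Rightarrow>
    'a::zero mat \<Rightarrow> 'a mat \<Rightarrow> 'a mat \<Rightarrow> 'a mat \<Rightarrow> 'a mat \<Rightarrow> bool" where
  "graded_ok gr degH h i p d' h' \<longleftrightarrow> graded_hip gr degH h i p \<and>
     (case gr of None \<Rightarrow> True | Some degC \<Rightarrow>
        homog degH degH 1 d' \<and> homog degH degH (-1) h')"

definition cond_i_at :: "nat \<Rightarrow> complex mat \<Rightarrow> complex mat \<Rightarrow> complex mat \<Rightarrow> complex mat \<Rightarrow> bool" where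
  "cond_i_at n D h i p \<longleftrightarrow> h * h = 0\<^sub>m n n \<and> h * D * h = h \<and>
     i * p = 1\<^sub>m n - D * h - h * D \<and> p * i = 1\<^sub>m (dim_col i) \<and> D * h * D = D"

definition good_data ::
  "('v::linorder) mpoly \<Rightarrow> 'v mpoly mat \<Rightarrow> ('v \<Rightarrow> complex) \<Rightarrow> nat \<Rightarrow> nat \<Rightarrow>
   (nat \<Rightarrow> int) option \<Rightarrow> (nat \<Rightarrow> int) \<Rightarrow>
   'v rfun mat \<Rightarrow> 'v rfun mat \<Rightarrow> 'v rfun mat \<Rightarrow> 'v rfun mat \<Rightarrow> 'v rfun mat \<Rightarrow> bool" where
  "good_data Q d q n r gr degH h i p d' h' \<longleftrightarrow>
    (let D = map_mat rf d;
         H = h + (inverse (rf Q)) \<cdot>\<^sub>m (i * h' * p) in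
     h \<in> carrier_mat n n \<and> i \<in> carrier_mat n r \<and> p \<in> carrier_mat r n \<and>
     d' \<in> carrier_mat r r \<and> h' \<in> carrier_mat r r \<and>
     mat_regular_at q h \<and> mat_regular_at q i \<and> mat_regular_at q p \<and>
     mat_regular_at q d' \<and> mat_regular_at q h' \<and>
     \<comment> \<open>(i)\<close>
     h * h = 0\<^sub>m n n \<and> h * D * h = h \<and> i * p = 1\<^sub>m n - D * h - h * D \<and> p * i = 1\<^sub>m r \<and>
     mat_val_at q (D * h * D - D) (0\<^sub>m n n) \<and>
     \<comment> \<open>(ii)\<close>
     p * D * i = rf Q \<cdot>\<^sub>m d' \<and> d' * d' = 0\<^sub>m r r \<and> h' * h' = 0\<^sub>m r r \<and>
     h' * d' + d' * h' = 1\<^sub>m r \<and>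
     \<comment> \<open>H\<close>
     H * H = 0\<^sub>m n n \<and> H * D + D * H = 1\<^sub>m n \<and>
     \<comment> \<open>grading\<close>
     graded_ok gr degH h i p d' h')"

end

theory Submission
  imports Defs "HOL-Computational_Algebra.Fundamental_Theorem_Algebra"
begin

text \<open>
  A contraction \<open>h0, i0, p0\<close> of \<open>d(q)\<close> onto its homology is perturbed to \<open>h, i, p\<close> over the local ring
  at \<open>q\<close> by the homological perturbation lemma, \<open>h = h0 (1 + (d - d(q)) h0)\<^sup>-\<^sup>1\<close>. At a point of \<open>Q = 0\<close>
  near \<open>q\<close> the homology of \<open>d\<close> has the same dimension as at \<open>q\<close>, which forces \<open>d h d = d\<close> there by a trace
  count, so \<open>p d i\<close> vanishes there. As \<open>Q = 0\<close> is smooth at \<open>q\<close>, \<open>Q\<close> divides \<open>p d i\<close> in the local ring;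
  this needs no unique factorization, since \<open>Q\<close> divides (derivative of \<open>Q\<close>) \<open>\<cdot>\<close> \<open>F\<close> on every line as soon as
  \<open>F\<close> vanishes on \<open>Q = 0\<close>. Differentiating \<open>p d i = Q d'\<close> at \<open>q\<close> identifies \<open>d'(q)\<close>, up to a nonzero
  scalar, with the exact differential induced on the homology. So \<open>d'(q)\<close> has a contraction with zero
  cokernel, and perturbing that one as well gives \<open>h'\<close>.
\<close>

section \<open>Polynomials as functions\<close>

text \<open>The identities of (i) over \<open>C(k)\<close> survive the perturbation because
  \<open>1 + (d - d(q)) h0\<close> is the identity matrix at \<open>q\<close>. The equation
  \<open>d h d = d\<close> does not: its defect \<open>d - d h d\<close> is
  \<open>i (p d i) p\<close>, so it is measured by the small matrix \<open>p d i\<close>. On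
  \<open>Q = 0\<close> the defect is controlled by comparing two counts. The trace of the idempotent
  \<open>i p\<close> gives \<open>n = r + 2 tr(d h)\<close>, while constancy of the homology
  dimension \<open>r\<close> gives \<open>n = r + 2 rank(d)\<close>; hence \<open>h\<close> inverts
  \<open>d\<close> on its whole image. Since \<open>h0\<close>, \<open>i0\<close>, \<open>p0\<close>
  are arbitrary initial data of the construction, the free choice of the values at \<open>q\<close>
  needs no separate argument. The second perturbation starts from a retract of dimension 0. That
  dimension cannot change, so \<open>h' d' + d' h' = 1\<close> holds over \<open>C(k)\<close> and
  not merely at \<open>q\<close>.\<close>

definition mon_val :: "('v::finite, nat) poly_mapping \<Rightarrow> ('v \<Rightarrow> complex) \<Rightarrow> complex" where
  "mon_val a k = (\<Prod>v\<in>UNIV. k v ^ Poly_Mapping.lookup a v)"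

text \<open>Summing over any finite set that contains the support lets polynomials with different
  supports be compared term by term.\<close>

lemma mpeval_superset:
  fixes p :: "'v::finite mpoly"
  assumes "finite S" "Poly_Mapping.keys p \<subseteq> S"
  shows "mpeval p k = (\<Sum>a\<in>S. Poly_Mapping.lookup p a * mon_val a k)"
proof -
  have m: "(\<Prod>v\<in>Poly_Mapping.keys a. k v ^ Poly_Mapping.lookup a v) = mon_val a k" for a :: "('v, nat) poly_mapping"
    unfolding mon_val_def by (rule prod.mono_neutral_left) (auto simp: in_keys_iff)
  have "mpeval p k = (\<Sum>a\<in>Poly_Mapping.keys p. Poly_Mapping.lookup p a * mon_val a k)"
    by (simp add: mpeval_def m)
  also have "\<dots> = (\<Sum>a\<in>S. Poly_Mapping.lookup p a * mon_val a k)"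
    by (rule sum.mono_neutral_left) (use assms in \<open>auto simp: in_keys_iff\<close>)
  finally show ?thesis .
qed

lemma mon_val_add: "mon_val (a + b) k = mon_val a k * mon_val b k"
  by (simp add: mon_val_def lookup_add power_add prod.distrib)

lemma mon_val_0 [simp]: "mon_val 0 k = 1"
  by (simp add: mon_val_def)

lemma mon_val_mult: "mon_val a (\<lambda>v. x v * y v) = mon_val a x * mon_val a y"
  by (simp add: mon_val_def power_mult_distrib prod.distrib)

lemma mon_val_one: "mon_val a (\<lambda>v. 1) = 1"
  by (simp add: mon_val_def)

lemma mon_val_single: "mon_val (Poly_Mapping.single v n) k = k v ^ n"
proof -
  have "mon_val (Poly_Mapping.single v n) k = (\<Prod>w\<in>UNIV. if w = v then k v ^ n else 1)"
    unfolding mon_val_def by (rule prod.cong) (auto simp: lookup_single when_def)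
  then show ?thesis by simp
qed

lemma mpeval_add [simp]:
  fixes p :: "'v::finite mpoly"
  shows "mpeval (p + p') k = mpeval p k + mpeval p' k"
proof -
  let ?S = "Poly_Mapping.keys p \<union> Poly_Mapping.keys p'"
  have "mpeval (p + p') k = (\<Sum>a\<in>?S. Poly_Mapping.lookup (p + p') a * mon_val a k)"
    "mpeval p k = (\<Sum>a\<in>?S. Poly_Mapping.lookup p a * mon_val a k)"
    "mpeval p' k = (\<Sum>a\<in>?S. Poly_Mapping.lookup p' a * mon_val a k)"
    using Poly_Mapping.keys_add[of p p'] by (intro mpeval_superset; auto)+
  then show ?thesis
    by (simp add: sum.distrib lookup_add distrib_right)
qed

lemma mpeval_0 [simp]: "mpeval (0 :: 'v::finite mpoly) k = 0"
  by (simp add: mpeval_def)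

lemma mpeval_sum:
  fixes f :: "'b \<Rightarrow> 'v::finite mpoly"
  shows "mpeval (\<Sum>x\<in>A. f x) k = (\<Sum>x\<in>A. mpeval (f x) k)"
  by (induction A rule: infinite_finite_induct) auto

lemma mpeval_single: "mpeval (Poly_Mapping.single a c :: 'v::finite mpoly) k = c * mon_val a k"
  by (subst mpeval_superset[of "{a}"]) auto

lemma poly_mapping_sum_monomials:
  fixes p :: "('b, 'c::comm_monoid_add) poly_mapping"
  shows "(\<Sum>a\<in>Poly_Mapping.keys p. Poly_Mapping.single a (Poly_Mapping.lookup p a)) = p"
proof (rule poly_mapping_eqI)
  fix b
  have "(\<Sum>a\<in>Poly_Mapping.keys p. Poly_Mapping.lookup p a when a = b) = 
      (\<Sum>a\<in>Poly_Mapping.keys p. if a = b then Poly_Mapping.lookup p b else 0)"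
    by (rule sum.cong) auto
  also have "\<dots> = Poly_Mapping.lookup p b"
    by (simp add: in_keys_iff)
  finally show "Poly_Mapping.lookup (\<Sum>a\<in>Poly_Mapping.keys p. Poly_Mapping.single a (Poly_Mapping.lookup p a)) b
      = Poly_Mapping.lookup p b"
    by (simp add: lookup_sum lookup_single)
qed

lemma mpeval_mult [simp]:
  fixes p :: "'v::finite mpoly"
  shows "mpeval (p * p') k = mpeval p k * mpeval p' k"
proof -
  have "mpeval (p * p') k = mpeval ((\<Sum>a\<in>Poly_Mapping.keys p. Poly_Mapping.single a (Poly_Mapping.lookup p a))
      * (\<Sum>a\<in>Poly_Mapping.keys p'. Poly_Mapping.single a (Poly_Mapping.lookup p' a))) k"
    by (simp only: poly_mapping_sum_monomials)
  also have "\<dots> = mpeval p k * mpeval p' k"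
    by (simp add: sum_product mpeval_sum mult_single mpeval_single mon_val_add algebra_simps
        mpeval_superset[of "Poly_Mapping.keys p" p] mpeval_superset[of "Poly_Mapping.keys p'" p'])
  finally show ?thesis .
qed

lemma mpeval_1 [simp]: "mpeval (1 :: 'v::finite mpoly) k = 1"
  by (metis single_one mpeval_single mon_val_0 mult_1)

interpretation mpeval_hom: comm_ring_hom "\<lambda>p :: 'v::finite mpoly. mpeval p k" for k
  by unfold_locales auto

definition cst :: "complex \<Rightarrow> 'v mpoly" where
  "cst c = Poly_Mapping.single 0 c"

lemma mpeval_cst [simp]: "mpeval (cst c :: 'v::finite mpoly) k = c"
  by (simp add: cst_def mpeval_single)

interpretation cst_hom: comm_ring_hom "cst :: complex \<Rightarrow> 'v::finite mpoly"
  by unfold_locales (auto simp: cst_def single_add mult_single)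

lemma mpoly_induct [case_names cst var add mult]:
  fixes p :: "'v::finite mpoly"
  assumes cst: "\<And>c. P (cst c)"
    and var: "\<And>v. P (Poly_Mapping.single (Poly_Mapping.single v 1) 1)"
    and add: "\<And>p p'. P p \<Longrightarrow> P p' \<Longrightarrow> P (p + p')"
    and mult: "\<And>p p'. P p \<Longrightarrow> P p' \<Longrightarrow> P (p * p')"
  shows "P p"
proof -
  have pow: "P (Poly_Mapping.single (Poly_Mapping.single v n) 1)" for v n
  proof (induction n)
    case 0
    then show ?case using cst[of 1] by (simp add: cst_def)
  next
    case (Suc n)
    have "Poly_Mapping.single (Poly_Mapping.single v (Suc n)) (1::complex) =
       Poly_Mapping.single (Poly_Mapping.single v 1) 1 * Poly_Mapping.single (Poly_Mapping.single v n) 1"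
      by (simp add: mult_single single_add[symmetric])
    then show ?case using mult[OF var Suc.IH] by simp
  qed
  have mon: "P (Poly_Mapping.single a 1)" for a
  proof -
    have "P (Poly_Mapping.single (\<Sum>v\<in>S. Poly_Mapping.single v (Poly_Mapping.lookup a v)) 1)" if "finite S" for S
      using that
    proof induction
      case empty
      then show ?case using cst[of 1] by (simp add: cst_def)
    next
      case (insert v S)
      have "Poly_Mapping.single (\<Sum>v\<in>insert v S. Poly_Mapping.single v (Poly_Mapping.lookup a v)) (1::complex) =
        Poly_Mapping.single (Poly_Mapping.single v (Poly_Mapping.lookup a v)) 1 *
        Poly_Mapping.single (\<Sum>v\<in>S. Poly_Mapping.single v (Poly_Mapping.lookup a v)) 1"
        using insert by (simp add: mult_single)
      then show ?case using mult[OF pow insert.IH] by simp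
    qed
    from this[of "Poly_Mapping.keys a"] show ?thesis by (simp add: poly_mapping_sum_monomials)
  qed
  have s: "P (Poly_Mapping.single a c)" for a c
  proof -
    have "Poly_Mapping.single a c = cst c * Poly_Mapping.single a 1" by (simp add: cst_def mult_single)
    then show ?thesis using mult[OF cst mon] by simp
  qed
  have "P (\<Sum>a\<in>S. Poly_Mapping.single a (Poly_Mapping.lookup p a))" if "finite S" for S
    using that
  proof induction
    case empty
    then show ?case using cst[of 0] by simp
  next
    case (insert a S)
    then show ?case using add[OF s insert.IH] by simp
  qed
  from this[of "Poly_Mapping.keys p"] show ?thesis by (simp add: poly_mapping_sum_monomials)
qed

text \<open>Artin's argument: distinct monomials are distinct characters of the multiplicative monoid of
  points, hence linearly independent.\<close>
lemma mon_val_independent: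
  fixes S :: "('v::finite, nat) poly_mapping set"
  assumes "finite S" "\<And>k. (\<Sum>a\<in>S. c a * mon_val a k) = 0"
  shows "\<forall>a\<in>S. c a = 0"
  using assms
proof (induction S arbitrary: c)
  case empty
  then show ?case by simp
next
  case (insert b S)
  have eq: "c b * mon_val b k + (\<Sum>a\<in>S. c a * mon_val a k) = 0" for k
    using insert.prems[of k] insert.hyps by simp
  have S: "c a = 0" if a: "a \<in> S" for a
  proof -
    obtain v where v: "Poly_Mapping.lookup a v \<noteq> Poly_Mapping.lookup b v"
      using a insert.hyps by (metis poly_mapping_eqI)
    \<comment> \<open>\<open>y\<close> doubles one coordinate in which \<open>a\<close> and
      \<open>b\<close> have different exponents. Subtracting \<open>mon_val b y\<close> times the
      relation at \<open>k\<close> from the relation at the scaled point removes the term of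
      \<open>b\<close>. The factor 2 serves because its powers are distinct.\<close>
    define y where "y = (\<lambda>w. if w = v then 2 else (1::complex))"
    have y: "mon_val e y = 2 ^ Poly_Mapping.lookup e v" for e
    proof -
      have "mon_val e y = (\<Prod>w\<in>UNIV. if w = v then 2 ^ Poly_Mapping.lookup e v else 1)"
        unfolding mon_val_def y_def by (rule prod.cong) auto
      then show ?thesis by simp
    qed
    have "(\<Sum>a\<in>S. (c a * (mon_val a y - mon_val b y)) * mon_val a k) = 0" for k
    proof -
      have "(\<Sum>a\<in>S. (c a * (mon_val a y - mon_val b y)) * mon_val a k) =
        (c b * mon_val b (\<lambda>v. y v * k v) + (\<Sum>a\<in>S. c a * mon_val a (\<lambda>v. y v * k v)))
         - mon_val b y * (c b * mon_val b k + (\<Sum>a\<in>S. c a * mon_val a k))"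
        by (simp add: mon_val_mult sum_distrib_left sum_subtractf algebra_simps)
      then show ?thesis by (simp add: eq)
    qed
    from insert.IH[OF this] a have "c a * (mon_val a y - mon_val b y) = 0" by blast
    moreover have "mon_val a y \<noteq> mon_val b y"
    proof
      assume "mon_val a y = mon_val b y"
      then have "norm (mon_val a y) = norm (mon_val b y)" by simp
      then show False using v by (simp add: y norm_power)
    qed
    ultimately show ?thesis by simp
  qed
  with eq[of "\<lambda>v. 1"] show ?case by (simp add: mon_val_one)
qed

text \<open>Identities between polynomials can therefore be checked pointwise; the divisibility test
  on lines concludes this way.\<close>

lemma mpeval_inject:
  fixes p :: "'v::finite mpoly"
  assumes "\<And>k. mpeval p k = mpeval p' k"
  shows "p = p'"
proof (rule poly_mapping_eqI)
  fix a
  let ?S = "insert a (Poly_Mapping.keys p \<union> Poly_Mapping.keys p')"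
  have "\<forall>a\<in>?S. Poly_Mapping.lookup p a - Poly_Mapping.lookup p' a = 0"
  proof (rule mon_val_independent)
    fix k
    have "mpeval p k = (\<Sum>a\<in>?S. Poly_Mapping.lookup p a * mon_val a k)"
      "mpeval p' k = (\<Sum>a\<in>?S. Poly_Mapping.lookup p' a * mon_val a k)"
      by (rule mpeval_superset; auto)+
    then show "(\<Sum>a\<in>?S. (Poly_Mapping.lookup p a - Poly_Mapping.lookup p' a) * mon_val a k) = 0"
      using assms[of k] by (simp add: left_diff_distrib sum_subtractf)
  qed simp
  then show "Poly_Mapping.lookup p a = Poly_Mapping.lookup p' a" by simp
qed

section \<open>Polynomial functions and restriction to lines\<close>

definition polyfun :: "(('v \<Rightarrow> complex) \<Rightarrow> complex) \<Rightarrow> bool" where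
  "polyfun f \<longleftrightarrow> (\<exists>p :: 'v mpoly. \<forall>k. f k = mpeval p k)"

lemma polyfun_const: "polyfun (\<lambda>k :: 'v::finite \<Rightarrow> complex. c)"
  unfolding polyfun_def by (rule exI[of _ "cst c"]) simp

lemma polyfun_var: "polyfun (\<lambda>k :: 'v::finite \<Rightarrow> complex. k v)"
  unfolding polyfun_def by (rule exI[of _ "Poly_Mapping.single (Poly_Mapping.single v 1) 1"])
    (simp add: mpeval_single mon_val_single)

lemma polyfun_add:
  fixes f :: "('v::finite \<Rightarrow> complex) \<Rightarrow> complex"
  shows "polyfun f \<Longrightarrow> polyfun g \<Longrightarrow> polyfun (\<lambda>k. f k + g k)"
  unfolding polyfun_def by (metis mpeval_add)

lemma polyfun_mult:
  fixes f :: "('v::finite \<Rightarrow> complex) \<Rightarrow> complex"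
  shows "polyfun f \<Longrightarrow> polyfun g \<Longrightarrow> polyfun (\<lambda>k. f k * g k)"
  unfolding polyfun_def by (metis mpeval_mult)

lemma polyfun_diff:
  fixes f :: "('v::finite \<Rightarrow> complex) \<Rightarrow> complex"
  assumes "polyfun f" "polyfun g" shows "polyfun (\<lambda>k. f k - g k)"
  using polyfun_add[OF assms(1) polyfun_mult[OF polyfun_const[of "-1"] assms(2)]] by simp

lemma polyfun_sum:
  fixes f :: "'b \<Rightarrow> ('v::finite \<Rightarrow> complex) \<Rightarrow> complex"
  shows "(\<And>x. x \<in> A \<Longrightarrow> polyfun (f x)) \<Longrightarrow> polyfun (\<lambda>k. \<Sum>x\<in>A. f x k)"
  by (induction A rule: infinite_finite_induct) (auto intro: polyfun_add polyfun_const)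

lemma polyfun_shift:
  fixes f :: "('v::finite \<Rightarrow> complex) \<Rightarrow> complex"
  assumes "polyfun f" shows "polyfun (\<lambda>k. f (\<lambda>x. k x - o' x))"
proof -
  obtain p :: "'v mpoly" where p: "\<And>k. f k = mpeval p k" using assms by (auto simp: polyfun_def)
  have "polyfun (\<lambda>k. mpeval p (\<lambda>x. k x - o' x))"
    by (induction p rule: mpoly_induct)
       (auto simp: mpeval_single mon_val_single intro: polyfun_add polyfun_mult polyfun_const polyfun_diff polyfun_var)
  then show ?thesis by (simp add: p)
qed

text \<open>\<open>A v\<close> is the Taylor expansion of \<open>p\<close> at \<open>o'\<close> in
  direction \<open>v\<close>: its coefficient of index \<open>j\<close> is the homogeneous part of
  degree \<open>j\<close>, evaluated at \<open>v\<close>. This explains both the polynomial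
  dependence on \<open>v\<close> and the degree bound uniform in \<open>v\<close>.\<close>

lemma restrict_to_lines:
  fixes p :: "'v::finite mpoly"
  obtains A :: "('v \<Rightarrow> complex) \<Rightarrow> complex poly" and N
  where "\<And>j. polyfun (\<lambda>v. coeff (A v) j)" "\<And>v. degree (A v) \<le> N"
    "\<And>v t. poly (A v) t = mpeval p (\<lambda>x. o' x + t * v x)"
proof -
  have "\<exists>A N. (\<forall>j. polyfun (\<lambda>v. coeff (A v) j)) \<and> (\<forall>v. degree (A v) \<le> N) \<and>
    (\<forall>v t. poly (A v) t = mpeval p (\<lambda>x. o' x + t * v x))"
  proof (induction p rule: mpoly_induct)
    case (cst c)
    show ?case by (rule exI[of _ "\<lambda>v. [:c:]"], rule exI[of _ 0]) (auto simp: polyfun_const)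
  next
    case (var x)
    show ?case
    proof (intro exI[of _ "\<lambda>v. [:o' x, v x:]"] exI[of _ 1] conjI allI)
      fix j
      show "polyfun (\<lambda>v. coeff [:o' x, v x:] j)"
        by (cases j; cases "j - 1") (auto simp: polyfun_const polyfun_var)
    qed (auto simp: mpeval_single mon_val_single)
  next
    case (add p p')
    then obtain A N A' N' where *: "\<forall>j. polyfun (\<lambda>v. coeff (A v) j)" "\<forall>v. degree (A v) \<le> N"
      "\<forall>v t. poly (A v) t = mpeval p (\<lambda>x. o' x + t * v x)"
      "\<forall>j. polyfun (\<lambda>v. coeff (A' v) j)" "\<forall>v. degree (A' v) \<le> N'"
      "\<forall>v t. poly (A' v) t = mpeval p' (\<lambda>x. o' x + t * v x)" by blast
    show ?case
      by (intro exI[of _ "\<lambda>v. A v + A' v"] exI[of _ "max N N'"] conjI allI)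
        (use * in \<open>auto intro!: polyfun_add degree_add_le intro: le_trans[OF _ max.cobounded1] le_trans[OF _ max.cobounded2]\<close>)
  next
    case (mult p p')
    then obtain A N A' N' where *: "\<forall>j. polyfun (\<lambda>v. coeff (A v) j)" "\<forall>v. degree (A v) \<le> N"
      "\<forall>v t. poly (A v) t = mpeval p (\<lambda>x. o' x + t * v x)"
      "\<forall>j. polyfun (\<lambda>v. coeff (A' v) j)" "\<forall>v. degree (A' v) \<le> N'"
      "\<forall>v t. poly (A' v) t = mpeval p' (\<lambda>x. o' x + t * v x)" by blast
    show ?case
      by (intro exI[of _ "\<lambda>v. A v * A' v"] exI[of _ "N + N'"] conjI allI)
        (use * in \<open>auto intro!: polyfun_sum polyfun_mult order_trans[OF degree_mult_le] add_mono simp: coeff_mult\<close>)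
  qed
  then show ?thesis using that by blast
qed

lemma poly_1_eq_sum_coeff:
  assumes "degree p \<le> N"
  shows "poly p (1 :: 'a :: comm_semiring_1) = (\<Sum>i\<le>N. coeff p i)"
proof -
  have "poly p 1 = (\<Sum>i\<le>degree p. coeff p i)" by (simp add: poly_altdef)
  also have "\<dots> = (\<Sum>i\<le>N. coeff p i)"
    by (rule sum.mono_neutral_left) (use assms in \<open>auto simp: coeff_eq_0\<close>)
  finally show ?thesis .
qed

text \<open>Divisibility by a polynomial \<open>b\<close> with \<open>b(o) \<noteq> 0\<close> can be tested on the lines through \<open>o\<close>: the
  Taylor coefficients at \<open>o\<close> of the quotient are polynomials in the direction, and those beyond a
  bounded degree vanish because the quotient is a polynomial on each line.\<close>
lemma dvd_if_dvd_on_lines: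
  fixes b :: "'v::finite mpoly"
  assumes a: "\<And>j. polyfun (\<lambda>v. coeff (A v) j)" "\<And>v. degree (A v) \<le> N"
      "\<And>v t. poly (A v) t = mpeval a (\<lambda>x. o' x + t * v x)"
    and b: "\<And>j. polyfun (\<lambda>v. coeff (B v) j)" 
      "\<And>v t. poly (B v) t = mpeval b (\<lambda>x. o' x + t * v x)"
    and b0: "mpeval b o' \<noteq> 0"
    and dvd: "\<And>v. B v dvd A v"
  shows "b dvd a"
proof -
  have B0: "coeff (B v) 0 = mpeval b o'" for v
    using b(2)[of v 0] by (simp add: poly_0_coeff_0)
  have Bn: "B v \<noteq> 0" for v using B0[of v] b0 by auto
  define C where "C v = A v div B v" for v
  have AC: "A v = B v * C v" for v using dvd[of v] by (simp add: C_def)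
  have dC: "degree (C v) \<le> N" for v
  proof (cases "C v = 0")
    case False
    then have "degree (A v) = degree (B v) + degree (C v)" using AC Bn degree_mult_eq by metis
    with a(2)[of v] show ?thesis by simp
  qed simp
  have cC: "polyfun (\<lambda>v. coeff (C v) j)" for j
  proof (induction j rule: less_induct)
    case (less j)
    \<comment> \<open>Power series division: the only divisor in the recursion is the constant term
      of \<open>B v\<close>, which is \<open>mpeval b o'\<close> in every direction, so no
      denominator depending on \<open>v\<close> appears.\<close>
    have "coeff (C v) j = (1 / mpeval b o') * (coeff (A v) j - (\<Sum>i<j. coeff (B v) (j - i) * coeff (C v) i))" for v
    proof -
      have "coeff (A v) j = (\<Sum>i\<le>j. coeff (C v) i * coeff (B v) (j - i))"
        by (simp add: AC[of v] mult.commute[of "B v"] coeff_mult)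
      also have "\<dots> = (\<Sum>i<j. coeff (B v) (j - i) * coeff (C v) i) + mpeval b o' * coeff (C v) j"
        by (simp add: lessThan_Suc_atMost[symmetric] B0 mult.commute)
      finally show ?thesis using b0 by (simp add: field_simps)
    qed
    moreover have "polyfun (\<lambda>v. (1 / mpeval b o') * (coeff (A v) j - (\<Sum>i<j. coeff (B v) (j - i) * coeff (C v) i)))"
      by (intro polyfun_mult polyfun_const polyfun_diff polyfun_sum a b less) auto
    ultimately show ?case by simp
  qed
  \<comment> \<open>The point \<open>k\<close> is reached at parameter 1 in direction
    \<open>k - o'\<close>, where the quotient is the sum of its Taylor coefficients. The uniform
    bound \<open>N\<close> makes this one fixed finite sum.\<close>
  have "polyfun (\<lambda>v. \<Sum>j\<le>N. coeff (C v) j)" by (intro polyfun_sum cC)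
  then have "polyfun (\<lambda>v. poly (C v) 1)"
    using poly_1_eq_sum_coeff[OF dC] by simp
  from polyfun_shift[OF this, of o'] obtain w :: "'v mpoly"
    where w: "\<And>k. poly (C (\<lambda>x. k x - o' x)) 1 = mpeval w k"
    by (auto simp: polyfun_def)
  have "a = b * w"
  proof (rule mpeval_inject)
    fix k
    let ?v = "\<lambda>x. k x - o' x"
    have "mpeval a k = poly (A ?v) 1" "mpeval b k = poly (B ?v) 1" using a(3)[of ?v 1] b(2)[of ?v 1] by auto
    then show "mpeval a k = mpeval (b * w) k" by (simp add: w[symmetric] AC[of ?v])
  qed
  then show ?thesis by simp
qed

text \<open>Split off one linear factor, \<open>B = L * B1\<close>. Then
  \<open>B' F = B1 F + L B1' F\<close>: in the first summand \<open>F\<close> contributes the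
  missing \<open>L\<close>, and induction handles the second, since roots of \<open>B1\<close> are
  roots of \<open>B\<close>.\<close>

lemma dvd_pderiv_mult_if_roots:
  fixes B F :: "complex poly"
  assumes "B \<noteq> 0" "\<And>z. poly B z = 0 \<Longrightarrow> poly F z = 0"
  shows "B dvd pderiv B * F"
  using assms
proof (induction "degree B" arbitrary: B)
  case 0
  then obtain c where "B = [:c:]" using degree_0_id by metis
  then show ?case by simp
next
  case (Suc n)
  then obtain z where z: "poly B z = 0"
    using fundamental_theorem_of_algebra[of B] constant_degree[of B] by auto
  then obtain B1 where B1: "B = [:-z, 1:] * B1" by (metis dvdE poly_eq_0_iff_dvd)
  obtain F1 where F1: "F = [:-z, 1:] * F1" using Suc.prems(2)[OF z] by (metis dvdE poly_eq_0_iff_dvd)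
  have B1n: "B1 \<noteq> 0" using B1 Suc.prems by auto
  have "degree B = Suc (degree B1)" using B1n by (simp add: B1 degree_mult_eq del: mult_pCons_left)
  then have n: "n = degree B1" using Suc.hyps by simp
  have "B1 dvd pderiv B1 * F"
    by (rule Suc.hyps(1)[OF n B1n]) (use Suc.prems(2) B1 in auto)
  then have "[:-z, 1:] * B1 dvd [:-z, 1:] * (pderiv B1 * F)" by (rule mult_dvd_mono[OF dvd_refl])
  moreover have "[:-z, 1:] * B1 dvd [:-z, 1:] * (B1 * F1)" by (rule mult_dvd_mono) auto
  ultimately have "[:-z, 1:] * B1 dvd [:-z, 1:] * (pderiv B1 * F) + [:-z, 1:] * (B1 * F1)" by (rule dvd_add)
  also have "[:-z, 1:] * (pderiv B1 * F) + [:-z, 1:] * (B1 * F1) = pderiv B * F"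
  proof -
    have p: "pderiv [:-z, 1:] = 1" by (simp add: pderiv_pCons)
    show ?thesis unfolding B1 pderiv_mult p by (subst (2) F1) (simp only: F1 algebra_simps mult_1_left)
  qed
  finally show ?case using B1 by simp
qed

section \<open>Directional derivatives and divisibility at a smooth point\<close>

lemma mpdir_eqI:
  assumes "((\<lambda>t. mpeval p (\<lambda>v. q v + t * xi v)) has_field_derivative c) (at 0)"
  shows "mpdir p q xi = c"
  unfolding mpdir_def using assms by (blast intro: DERIV_unique)

lemma mpdir_has_derivative:
  fixes p :: "'v::finite mpoly"
  shows "((\<lambda>t. mpeval p (\<lambda>v. q v + t * xi v)) has_field_derivative mpdir p q xi) (at 0)"
proof -
  obtain A :: "('v \<Rightarrow> complex) \<Rightarrow> complex poly" and N
  where "\<And>v t. poly (A v) t = mpeval p (\<lambda>x. q x + t * v x)"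
    using restrict_to_lines[of p q] by metis
  then have "((\<lambda>t. mpeval p (\<lambda>v. q v + t * xi v)) has_field_derivative poly (pderiv (A xi)) 0) (at 0)"
    using poly_DERIV[of "A xi" 0] by simp
  with mpdir_eqI[OF this] show ?thesis by simp
qed

lemma mpdir_add: "mpdir (p + p' :: 'v::finite mpoly) q xi = mpdir p q xi + mpdir p' q xi"
  by (rule mpdir_eqI) (simp add: DERIV_add mpdir_has_derivative)

lemma mpdir_mult: "mpdir (p * p' :: 'v::finite mpoly) q xi = mpdir p q xi * mpeval p' q + mpeval p q * mpdir p' q xi"
  using DERIV_mult[OF mpdir_has_derivative[of p q xi] mpdir_has_derivative[of p' q xi]]
  by (intro mpdir_eqI) (simp add: algebra_simps)

lemma mpdir_cst [simp]: "mpdir (cst c :: 'v::finite mpoly) q xi = 0"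
  by (rule mpdir_eqI) simp

lemma mpdir_sum:
  fixes f :: "'b \<Rightarrow> 'v::finite mpoly"
  shows "mpdir (\<Sum>x\<in>A. f x) q xi = (\<Sum>x\<in>A. mpdir (f x) q xi)"
proof -
  have "mpdir (0 :: 'v mpoly) q xi = 0" by (rule mpdir_eqI) simp
  then show ?thesis by (induction A rule: infinite_finite_induct) (auto simp: mpdir_add)
qed

text \<open>With \<open>S\<close> the derivative of \<open>Q\<close> in the radial direction from a point \<open>o\<close> off the hypersurface,
  \<open>Q\<close> divides \<open>S F\<close> on every line through \<open>o\<close>, because a root of multiplicity \<open>m\<close> of \<open>Q\<close> is one of
  multiplicity at least \<open>m - 1\<close> of \<open>S\<close>. Taking \<open>o\<close> near \<open>q\<close> in a direction transversal to the
  hypersurface makes \<open>S\<close> nonzero at \<open>q\<close>.\<close>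
lemma local_nullstellensatz:
  fixes Q :: "'v::finite mpoly"
  assumes q: "mpeval Q q = 0" and xi: "mpdir Q q xi \<noteq> 0"
  obtains S where "mpeval S q \<noteq> 0" 
    "\<And>F. (\<And>k. mpeval Q k = 0 \<Longrightarrow> mpeval F k = 0) \<Longrightarrow> Q dvd S * F"
proof -
  \<comment> \<open>If \<open>Q\<close> vanished on the whole line through \<open>q\<close> in
    direction \<open>xi\<close>, its derivative along \<open>xi\<close> would be zero.\<close>
  have "\<exists>\<tau>. \<tau> \<noteq> 0 \<and> mpeval Q (\<lambda>v. q v + \<tau> * xi v) \<noteq> 0"
  proof (rule ccontr)
    assume "\<not> ?thesis"
    then have "mpeval Q (\<lambda>v. q v + \<tau> * xi v) = 0" for \<tau>
      using q by (cases "\<tau> = 0") auto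
    then have "mpdir Q q xi = 0" by (intro mpdir_eqI) simp
    with xi show False by simp
  qed
  then obtain \<tau> where \<tau>: "\<tau> \<noteq> 0" "mpeval Q (\<lambda>v. q v + \<tau> * xi v) \<noteq> 0" by blast
  define o' where "o' = (\<lambda>v. q v + \<tau> * xi v)"
  obtain B N where B: "\<And>j. polyfun (\<lambda>v. coeff (B v) j)" "\<And>v. degree (B v) \<le> N"
    "\<And>v t. poly (B v) t = mpeval Q (\<lambda>x. o' x + t * v x)"
    using restrict_to_lines[of Q o'] by metis
  have Bn: "B v \<noteq> 0" for v using B(3)[of v 0] \<tau> by (auto simp: o'_def)
  have "polyfun (\<lambda>v. poly (pderiv (B v)) 1)"
  proof -
    have "poly (pderiv (B v)) 1 = (\<Sum>i\<le>N. of_nat (Suc i) * coeff (B v) (Suc i))" for v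
      using poly_1_eq_sum_coeff[of "pderiv (B v)" N] B(2)[of v] by (simp add: degree_pderiv coeff_pderiv)
    then show ?thesis by (simp add: polyfun_sum polyfun_mult polyfun_const B(1) del: of_nat_Suc)
  qed
  from polyfun_shift[OF this, of o'] obtain S :: "'v mpoly"
    where S: "\<And>k. poly (pderiv (B (\<lambda>x. k x - o' x))) 1 = mpeval S k"
    by (auto simp: polyfun_def)
  \<comment> \<open>Rescaling the direction rescales the parameter. By the chain rule the derivative
    at parameter 1 in direction \<open>t v\<close> is \<open>t\<close> times the derivative at
    \<open>t\<close> in direction \<open>v\<close>; this is the factor \<open>[:0, 1:]\<close> in
    \<open>Sline\<close>.\<close>
  have Bscale: "B (\<lambda>x. t * v x) = pcompose (B v) [:0, t:]" for t v
    by (rule poly_eq_poly_eq_iff[THEN iffD1], rule ext)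
       (simp add: B(3) poly_pcompose algebra_simps)
  have Sline: "poly ([:0, 1:] * pderiv (B v)) t = mpeval S (\<lambda>x. o' x + t * v x)" for v t
  proof -
    have "mpeval S (\<lambda>x. o' x + t * v x) = poly (pderiv (B (\<lambda>x. t * v x))) 1" by (simp add: S[symmetric])
    also have "\<dots> = poly ([:0, 1:] * pderiv (B v)) t"
      by (simp add: Bscale pderiv_pcompose poly_pcompose pderiv_pCons)
    finally show ?thesis by simp
  qed
  show ?thesis
  proof
    have "mpeval S q = poly (pderiv (B (\<lambda>x. q x - o' x))) 1" by (simp add: S)
    moreover have "poly (pderiv (B (\<lambda>x. q x - o' x))) 1 = - (\<tau> * mpdir Q q xi)"
    proof -
      let ?v = "\<lambda>x. q x - o' x"
      \<comment> \<open>The line from \<open>o'\<close> to \<open>q\<close> is the line through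
        \<open>q\<close> in direction \<open>xi\<close>, reparametrised: parameter
        \<open>1 - t / \<tau>\<close> is the point \<open>q + t xi\<close>.\<close>
      have "((\<lambda>t. poly (B ?v) (1 - t / \<tau>)) has_field_derivative poly (pderiv (B ?v)) 1 * (- 1 / \<tau>)) (at 0)"
        by (rule DERIV_chain2[of "poly (B ?v)"])
          (use poly_DERIV[of "B ?v" 1] \<tau> in \<open>auto intro!: derivative_eq_intros\<close>)
      moreover have "poly (B ?v) (1 - t / \<tau>) = mpeval Q (\<lambda>v. q v + t * xi v)" for t
        using \<tau> by (simp add: B(3) o'_def field_simps)
      ultimately have "mpdir Q q xi = poly (pderiv (B ?v)) 1 * (- 1 / \<tau>)"
        by (intro mpdir_eqI) simp
      then show ?thesis using \<tau> by (simp add: field_simps)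
    qed
    ultimately show "mpeval S q \<noteq> 0" using \<tau> xi by auto
  next
    fix F :: "'v mpoly"
    assume F: "\<And>k. mpeval Q k = 0 \<Longrightarrow> mpeval F k = 0"
    obtain A M where A: "\<And>j. polyfun (\<lambda>v. coeff (A v) j)" "\<And>v. degree (A v) \<le> M"
      "\<And>v t. poly (A v) t = mpeval (S * F) (\<lambda>x. o' x + t * v x)"
      using restrict_to_lines[of "S * F" o'] by metis
    obtain G M' where G: "\<And>v. degree (G v) \<le> M'"
      "\<And>v t. poly (G v) t = mpeval F (\<lambda>x. o' x + t * v x)"
      using restrict_to_lines[of F o'] by metis
    show "Q dvd S * F"
    proof (rule dvd_if_dvd_on_lines[OF A B(1,3)])
      show "mpeval Q o' \<noteq> 0" using \<tau> by (simp add: o'_def)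
      fix v
      have "A v = [:0, 1:] * (pderiv (B v) * G v)"
        by (rule poly_eq_poly_eq_iff[THEN iffD1], rule ext) (use A(3) G(2) Sline in \<open>simp add: mult.assoc\<close>)
      moreover have "B v dvd pderiv (B v) * G v"
        by (rule dvd_pderiv_mult_if_roots[OF Bn]) (simp add: B(3) G(2) F)
      ultimately show "B v dvd A v" by (metis dvd_mult)
    qed
  qed
qed

section \<open>Contractions and their perturbation\<close>

lemma mat_assoc:
  fixes A B C :: "'a::semiring_0 mat"
  assumes "dim_col A = dim_row B" "dim_col B = dim_row C"
  shows "(A * B) * C = A * (B * C)"
  by (rule assoc_mult_mat[of A "dim_row A" "dim_row B" B "dim_row C" C "dim_col C"])
    (use assms in auto)

lemma mat_distrib_left:
  fixes A B C :: "'a::semiring_0 mat"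
  assumes "dim_col A = dim_row B" "dim_row B = dim_row C" "dim_col B = dim_col C"
  shows "A * (B + C) = A * B + A * C"
  by (rule mult_add_distrib_mat[of A "dim_row A" "dim_row B" B "dim_col C" C])
    (use assms in auto)

lemma mat_distrib_right:
  fixes A B C :: "'a::semiring_0 mat"
  assumes "dim_col A = dim_row C" "dim_row A = dim_row B" "dim_col A = dim_col B"
  shows "(A + B) * C = A * C + B * C"
  by (rule add_mult_distrib_mat[of A "dim_row A" "dim_row C" B C "dim_col C"])
    (use assms in auto)

lemma mat_diff_left:
  fixes A B C :: "'a::ring mat"
  assumes "dim_col A = dim_row B" "dim_row B = dim_row C" "dim_col B = dim_col C"
  shows "A * (B - C) = A * B - A * C"
  by (rule mult_minus_distrib_mat[of A "dim_row A" "dim_row B" B "dim_col C" C])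
    (use assms in auto)

lemma mat_diff_right:
  fixes A B C :: "'a::ring mat"
  assumes "dim_col A = dim_row C" "dim_row A = dim_row B" "dim_col A = dim_col B"
  shows "(A - B) * C = A * C - B * C"
  by (rule minus_mult_distrib_mat[of A "dim_row A" "dim_row C" B C "dim_col C"])
    (use assms in auto)

lemma mat_one_left: "dim_row A = n \<Longrightarrow> 1\<^sub>m n * A = (A :: 'a::semiring_1 mat)"
  by (rule left_mult_one_mat') simp

lemma mat_one_right: "dim_col A = n \<Longrightarrow> A * 1\<^sub>m n = (A :: 'a::semiring_1 mat)"
  by (rule right_mult_one_mat') simp

lemma mat_zero_left: "dim_row A = n \<Longrightarrow> 0\<^sub>m m n * A = (0\<^sub>m m (dim_col A) :: 'a::semiring_0 mat)"
  by (rule left_mult_zero_mat) auto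

lemma mat_zero_right: "dim_col A = n \<Longrightarrow> A * 0\<^sub>m n m = (0\<^sub>m (dim_row A) m :: 'a::semiring_0 mat)"
  by (rule right_mult_zero_mat) auto

lemma mat_smult_left:
  fixes A B :: "'a::comm_semiring_0 mat"
  shows "dim_col A = dim_row B \<Longrightarrow> (c \<cdot>\<^sub>m A) * B = c \<cdot>\<^sub>m (A * B)"
  by (rule mult_smult_assoc_mat[of A "dim_row A" "dim_row B" B "dim_col B"]) auto

lemma mat_smult_right:
  fixes A B :: "'a::comm_semiring_0 mat"
  shows "dim_col A = dim_row B \<Longrightarrow> A * (c \<cdot>\<^sub>m B) = c \<cdot>\<^sub>m (A * B)"
  by (rule mult_smult_distrib[of A "dim_row A" "dim_row B" B "dim_col B"]) auto

text \<open>Stated with dimensions instead of carriers, the ring laws can be used as rewrite rules.\<close>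
lemmas mat_ring = mat_assoc mat_distrib_left mat_distrib_right mat_diff_left mat_diff_right
  mat_one_left mat_one_right mat_zero_left mat_zero_right mat_smult_left mat_smult_right

text \<open>Products are kept associated to the right, so an equation \<open>A * B = C\<close> does
  not match inside a longer product. This variant, like \<open>mat_rewr3\<close> for three factors,
  carries the trailing factor along.\<close>

lemma mat_rewr2:
  fixes A B C X :: "'a::semiring_0 mat"
  assumes "A * B = C" "dim_col A = dim_row B" "dim_col B = dim_row X"
  shows "A * (B * X) = C * X"
  using assms by (simp add: mat_assoc[symmetric])

lemma mat_rewr3:
  fixes A B C E X :: "'a::semiring_0 mat"
  assumes "A * (B * C) = E" "dim_col A = dim_row B" "dim_col B = dim_row C" "dim_col C = dim_row X"
  shows "A * (B * (C * X)) = E * X"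
  using assms by (simp add: mat_assoc[symmetric])

text \<open>Since \<open>p i = 1\<close>, one has \<open>i = (i p) i\<close> and
  \<open>p = p (i p)\<close>; once \<open>i p\<close> is replaced by \<open>1 - D h - h D\<close>,
  everything cancels by \<open>h h = 0\<close> and \<open>h D h = h\<close>. Only identities that
  persist over the function field enter, where \<open>D i\<close> need not vanish.\<close>

lemma contraction_side_conditions:
  fixes D h i p :: "'a::comm_ring_1 mat"
  assumes c: "D \<in> carrier_mat n n" "h \<in> carrier_mat n n" "i \<in> carrier_mat n r" "p \<in> carrier_mat r n"
    and hh: "h * h = 0\<^sub>m n n" and hDh: "h * D * h = h"
    and ip: "i * p = 1\<^sub>m n - D * h - h * D" and pi: "p * i = 1\<^sub>m r"
  shows "h * i = 0\<^sub>m n r" "p * h = 0\<^sub>m r n" "p * (D * h) = 0\<^sub>m r n" "h * (D * i) = 0\<^sub>m n r"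
proof -
  note d = carrier_matD[OF c(1)] carrier_matD[OF c(2)] carrier_matD[OF c(3)] carrier_matD[OF c(4)]
  have hDh': "h * (D * h) = h" using hDh d by (simp add: mat_ring)
  note rw = hh mat_rewr2[OF hh] hDh' mat_rewr3[OF hDh']
  have "h * i = h * ((i * p) * i)" using d by (simp add: mat_ring pi)
  also have "\<dots> = 0\<^sub>m n r" unfolding ip using d
    by (simp add: mat_ring rw) (rule eq_matI; simp del: index_mult_mat(1))
  finally show hi: "h * i = 0\<^sub>m n r" .
  have "p * h = (p * (i * p)) * h" using d by (simp add: mat_assoc[symmetric] pi mat_one_left)
  also have "\<dots> = 0\<^sub>m r n" unfolding ip using d
    by (simp add: mat_ring rw) (rule eq_matI; simp del: index_mult_mat(1))
  finally show ph: "p * h = 0\<^sub>m r n" .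
  have "p * (D * h) = p * (1\<^sub>m n - i * p - h * D)" 
    unfolding ip using d by (intro arg_cong[of _ _ "\<lambda>x. p * x"] eq_matI) (auto simp del: index_mult_mat(1))
  also have "\<dots> = 0\<^sub>m r n" using d
    by (simp add: mat_ring mat_rewr2[OF ph] mat_rewr2[OF pi]) (rule eq_matI; simp del: index_mult_mat(1))
  finally show "p * (D * h) = 0\<^sub>m r n" .
  have "h * (D * i) = (1\<^sub>m n - i * p - D * h) * i"
    unfolding ip using d by (subst mat_assoc[symmetric]; simp?; intro arg_cong[of _ _ "\<lambda>x. x * i"] eq_matI) 
      (auto simp del: index_mult_mat(1))
  also have "\<dots> = 0\<^sub>m n r" using d
    by (simp add: mat_ring hi pi) (rule eq_matI; simp del: index_mult_mat(1))
  finally show "h * (D * i) = 0\<^sub>m n r" .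
qed

text \<open>Multiplying \<open>1 - D h - h D\<close> by \<open>D\<close> on either side gives 0, so
  \<open>i\<close> lands in the cycles and \<open>p\<close> kills the boundaries. This is used for
  values of the differential at a point, where \<open>D h D = D\<close> is known.\<close>

lemma contraction_cycles:
  fixes D h i p :: "'a::comm_ring_1 mat"
  assumes c: "D \<in> carrier_mat n n" "h \<in> carrier_mat n n" "i \<in> carrier_mat n r" "p \<in> carrier_mat r n"
    and DD: "D * D = 0\<^sub>m n n" and ip: "i * p = 1\<^sub>m n - D * h - h * D" and pi: "p * i = 1\<^sub>m r"
    and DhD: "D * h * D = D"
  shows "D * i = 0\<^sub>m n r" "p * D = 0\<^sub>m r n"
proof -
  note d = carrier_matD[OF c(1)] carrier_matD[OF c(2)] carrier_matD[OF c(3)] carrier_matD[OF c(4)]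
  have DhD': "D * (h * D) = D" using DhD d by (simp add: mat_ring)
  have "D * i = D * (i * p) * i" using d by (simp add: mat_ring pi)
  also have "\<dots> = 0\<^sub>m n r" unfolding ip using d
    by (simp add: mat_ring DD mat_rewr2[OF DD] mat_rewr3[OF DhD']) (rule eq_matI; simp del: index_mult_mat(1))
  finally show "D * i = 0\<^sub>m n r" .
  have "p * D = (p * (i * p)) * D" using d by (simp add: mat_assoc[symmetric] pi mat_one_left)
  also have "\<dots> = 0\<^sub>m r n" unfolding ip using d
    by (simp add: mat_ring DD mat_rewr2[OF DD] DhD') (rule eq_matI; simp del: index_mult_mat(1))
  finally show "p * D = 0\<^sub>m r n" .
qed

text \<open>The last two hypotheses on \<open>h\<close>, \<open>R1\<close> and \<open>R2\<close>, say that
  \<open>h = h0 (1 + E h0)\<^sup>-\<^sup>1 = (1 + h0 E)\<^sup>-\<^sup>1 h0\<close>.\<close>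
lemma perturbation:
  fixes D0 E h0 i0 p0 h :: "'a::comm_ring_1 mat"
  assumes c: "D0 \<in> carrier_mat n n" "E \<in> carrier_mat n n" "h0 \<in> carrier_mat n n"
      "i0 \<in> carrier_mat n r" "p0 \<in> carrier_mat r n" "h \<in> carrier_mat n n"
    and DD: "D0 * D0 = 0\<^sub>m n n" and dd: "(D0 + E) * (D0 + E) = 0\<^sub>m n n"
    and hh: "h0 * h0 = 0\<^sub>m n n" and hDh: "h0 * D0 * h0 = h0"
    and ip: "i0 * p0 = 1\<^sub>m n - D0 * h0 - h0 * D0" and pi: "p0 * i0 = 1\<^sub>m r"
    and DhD: "D0 * h0 * D0 = D0"
    and R1: "h0 * (E * h) = h0 - h" and R2: "h * (E * h0) = h0 - h"
    and i_eq: "i = i0 - h * E * i0" and p_eq: "p = p0 - p0 * E * h"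
  shows "h * h = 0\<^sub>m n n" "h * (D0 + E) * h = h"
    "i * p = 1\<^sub>m n - (D0 + E) * h - h * (D0 + E)" "p * i = 1\<^sub>m r"
    "p * (D0 + E) * i = p0 * (E - E * h * E) * i0"
proof -
  note d = carrier_matD[OF c(1)] carrier_matD[OF c(2)] carrier_matD[OF c(3)]
    carrier_matD[OF c(4)] carrier_matD[OF c(5)] carrier_matD[OF c(6)]
  have hDh': "h0 * (D0 * h0) = h0" "D0 * (h0 * D0) = D0" using hDh DhD d by (simp_all add: mat_ring)
  note side = contraction_side_conditions[OF c(1,3,4,5) hh hDh ip pi]
  note cyc = contraction_cycles[OF c(1,3,4,5) DD ip pi DhD]
  \<comment> \<open>The first form exposes \<open>h0\<close> at the left end of every term, the
    second at the right end, ready to be absorbed by the side conditions.\<close>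
  have h_eq: "h = h0 - h0 * (E * h)" "h = h0 - h * (E * h0)"
    unfolding R1 R2 using d by (auto intro!: eq_matI)
  note Di = cyc(1) and pD = cyc(2)
  have hi: "h * i0 = 0\<^sub>m n r"
    by (subst h_eq(2)) (use d in \<open>simp add: mat_ring side; auto intro!: eq_matI\<close>)
  have ph: "p0 * h = 0\<^sub>m r n"
    by (subst h_eq(1)) (use d in \<open>simp add: mat_ring side mat_rewr2[OF side(2)]; auto intro!: eq_matI\<close>)
  have hh0: "h * h0 = 0\<^sub>m n n"
    by (subst h_eq(2)) (use d in \<open>simp add: mat_ring hh; auto intro!: eq_matI\<close>)
  show hh1: "h * h = 0\<^sub>m n n"
    by (subst (2) h_eq(1)) (use d in \<open>simp add: mat_ring hh0 mat_rewr2[OF hh0]; auto intro!: eq_matI\<close>)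
  have "h * (D0 * h0) = (h0 - h * (E * h0)) * (D0 * h0)" using h_eq(2) by simp
  also have "\<dots> = h0 - h * (E * h0)" using d by (simp add: mat_ring hDh')
  finally have hDh0: "h * (D0 * h0) = h" using h_eq(2) by simp
  have hDh1: "h * (D0 * h) = h - h * (E * h)"
    by (subst (2) h_eq(1)) (use d in \<open>simp add: mat_ring mat_rewr3[OF hDh0] hDh0\<close>)
  show "h * (D0 + E) * h = h"
    using d by (simp add: mat_ring hDh1) (auto intro!: eq_matI simp del: index_mult_mat(1))
  \<comment> \<open>The Maurer-Cartan equation of the perturbation, solved for \<open>E * E\<close>
    so that it can serve as a rewrite rule in the computation of \<open>i * p\<close>.\<close>
  have EE: "E * E = 0\<^sub>m n n - D0 * E - E * D0"
  proof (rule eq_matI)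
    fix a b assume "a < dim_row (0\<^sub>m n n - D0 * E - E * D0)" "b < dim_col (0\<^sub>m n n - D0 * E - E * D0)"
    then have ab: "a < n" "b < n" using d by auto
    have "(D0 + E) * (D0 + E) = D0 * D0 + D0 * E + (E * D0 + E * E)"
      using d by (simp add: mat_ring; auto intro!: eq_matI simp del: index_mult_mat(1))
    from arg_cong[OF this, of "\<lambda>M. M $$ (a, b)"] ab d
    have "0 = (D0 * E) $$ (a, b) + (E * D0) $$ (a, b) + (E * E) $$ (a, b)"
      by (simp add: dd DD add_ac del: index_mult_mat(1))
    then have "(E * E) $$ (a, b) = - (D0 * E) $$ (a, b) - (E * D0) $$ (a, b)"
      by (metis add.commute add_diff_cancel_left' diff_0 diff_diff_eq)
    then show "(E * E) $$ (a, b) = (0\<^sub>m n n - D0 * E - E * D0) $$ (a, b)"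
      using ab d by (simp del: index_mult_mat(1))
  qed (use d in auto)
  show "p * i = 1\<^sub>m r"
    unfolding i_eq p_eq using d
    by (simp add: mat_ring pi hi ph mat_rewr2[OF ph] mat_rewr2[OF hh1]; auto intro!: eq_matI)
  show "p * (D0 + E) * i = p0 * (E - E * h * E) * i0"
    unfolding i_eq p_eq using d
    by (simp add: mat_ring Di pD mat_rewr2[OF pD] mat_rewr3[OF hDh1])
      (auto intro!: eq_matI simp del: index_mult_mat(1))
  have ip': "i0 * (p0 * X) = X - D0 * (h0 * X) - h0 * (D0 * X)" if "dim_row X = n" for X
  proof -
    have "i0 * (p0 * X) = (i0 * p0) * X" using d that by (simp add: mat_ring)
    then show ?thesis unfolding ip using d that by (simp add: mat_ring)
  qed
  show "i * p = 1\<^sub>m n - (D0 + E) * h - h * (D0 + E)"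
    unfolding i_eq p_eq using d
    by (simp add: mat_ring ip ip' R1 R2 mat_rewr3[OF R1] mat_rewr3[OF R2] mat_rewr2[OF EE])
      (rule eq_matI; simp del: index_mult_mat(1))
qed

section \<open>Homogeneous matrices and traces\<close>

text \<open>In the middle stands \<open>D * (i * p) * D\<close>, and every term of
  \<open>i * p\<close> produces a factor \<open>D * D\<close>.\<close>

lemma compressed_differential_square:
  fixes D h i p :: "'a::comm_ring_1 mat"
  assumes c: "D \<in> carrier_mat n n" "h \<in> carrier_mat n n" "i \<in> carrier_mat n r" "p \<in> carrier_mat r n"
    and DD: "D * D = 0\<^sub>m n n" and ip: "i * p = 1\<^sub>m n - D * h - h * D"
  shows "(p * D * i) * (p * D * i) = 0\<^sub>m r r"
proof -
  note d = carrier_matD[OF c(1)] carrier_matD[OF c(2)] carrier_matD[OF c(3)] carrier_matD[OF c(4)]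
  have "(p * D * i) * (p * D * i) = p * (D * ((i * p) * (D * i)))" using d by (simp add: mat_ring)
  also have "\<dots> = 0\<^sub>m r r" unfolding ip using d
    by (simp add: mat_ring DD mat_rewr2[OF DD]; auto intro!: eq_matI simp del: index_mult_mat(1))
  finally show ?thesis .
qed

text \<open>Because \<open>p D h = 0\<close> and \<open>h D i = 0\<close>, inserting
  \<open>1 = i p + D h + h D\<close> gives \<open>p D = Q d' p\<close> and
  \<open>D i = Q i d'\<close>, so \<open>i\<close> and \<open>p\<close> intertwine \<open>D\<close>
  with \<open>Q d'\<close>. The factor \<open>1/Q\<close> of the correction cancels this
  \<open>Q\<close>, and \<open>h' d' + d' h' = 1\<close> supplies the summand \<open>i p\<close>
  that \<open>h\<close> alone misses.\<close>

lemma total_contraction: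
  fixes D h i p :: "'a::field mat"
  assumes c: "D \<in> carrier_mat n n" "h \<in> carrier_mat n n" "i \<in> carrier_mat n r" "p \<in> carrier_mat r n"
      "d' \<in> carrier_mat r r" "h' \<in> carrier_mat r r"
    and DD: "D * D = 0\<^sub>m n n"
    and hh: "h * h = 0\<^sub>m n n" and hDh: "h * D * h = h"
    and ip: "i * p = 1\<^sub>m n - D * h - h * D" and pi: "p * i = 1\<^sub>m r"
    and pDi: "p * D * i = Q \<cdot>\<^sub>m d'" and Q: "Q \<noteq> 0"
    and hh': "h' * h' = 0\<^sub>m r r" and hd': "h' * d' + d' * h' = 1\<^sub>m r"
  shows "(h + inverse Q \<cdot>\<^sub>m (i * h' * p)) * (h + inverse Q \<cdot>\<^sub>m (i * h' * p)) = 0\<^sub>m n n"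
    "(h + inverse Q \<cdot>\<^sub>m (i * h' * p)) * D + D * (h + inverse Q \<cdot>\<^sub>m (i * h' * p)) = 1\<^sub>m n"
proof -
  note d = carrier_matD[OF c(1)] carrier_matD[OF c(2)] carrier_matD[OF c(3)] carrier_matD[OF c(4)]
     carrier_matD[OF c(5)] carrier_matD[OF c(6)]
  note side = contraction_side_conditions[OF c(1-4) hh hDh ip pi]
  have pDi': "p * (D * i) = Q \<cdot>\<^sub>m d'" using pDi d by (simp add: mat_ring)
  have one: "1\<^sub>m n = i * p + D * h + h * D"
    unfolding ip using d by (auto intro!: eq_matI simp del: index_mult_mat(1))
  have "p * D = p * (D * 1\<^sub>m n)" using d by (simp add: mat_ring)
  also have "\<dots> = Q \<cdot>\<^sub>m (d' * p)" unfolding one using d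
    by (simp add: mat_ring mat_rewr3[OF pDi'] mat_rewr3[OF side(3)] mat_rewr2[OF DD];
      auto intro!: eq_matI simp del: index_mult_mat(1))
  finally have pD: "p * D = Q \<cdot>\<^sub>m (d' * p)" .
  have "D * i = 1\<^sub>m n * (D * i)" using d by (simp add: mat_ring)
  also have "\<dots> = Q \<cdot>\<^sub>m (i * d')" unfolding one using d
    by (simp add: mat_ring pDi' side mat_rewr2[OF DD]; auto intro!: eq_matI simp del: index_mult_mat(1))
  finally have Di: "D * i = Q \<cdot>\<^sub>m (i * d')" .
  show "(h + inverse Q \<cdot>\<^sub>m (i * h' * p)) * (h + inverse Q \<cdot>\<^sub>m (i * h' * p)) = 0\<^sub>m n n"
    using d by (simp add: mat_ring hh side mat_rewr2[OF side(1)] mat_rewr2[OF pi] mat_rewr2[OF hh'];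
      auto intro!: eq_matI simp del: index_mult_mat(1))
  have "i * p = i * ((h' * d' + d' * h') * p)" unfolding hd' using d by (simp add: mat_ring)
  also have "\<dots> = i * (h' * (d' * p)) + i * (d' * (h' * p))" using d by (simp add: mat_ring)
  finally have ip': "i * p = i * (h' * (d' * p)) + i * (d' * (h' * p))" .
  have Q': "inverse Q * (Q * x) = x" "Q * (inverse Q * x) = x" for x using Q by simp_all
  have "(h + inverse Q \<cdot>\<^sub>m (i * h' * p)) * D + D * (h + inverse Q \<cdot>\<^sub>m (i * h' * p)) = 
     i * p + D * h + h * D"
    unfolding ip' using d
    by (simp add: mat_ring pD mat_rewr2[OF Di]; auto intro!: eq_matI simp: Q' algebra_simps simp del: index_mult_mat(1))
  then show "(h + inverse Q \<cdot>\<^sub>m (i * h' * p)) * D + D * (h + inverse Q \<cdot>\<^sub>m (i * h' * p)) = 1\<^sub>m n"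
    by (simp only: one)
qed

text \<open>\<open>k = g D g\<close> already satisfies \<open>k D k = k\<close> and
  \<open>D k D = D\<close>. Subtracting \<open>k k D\<close> makes the square vanish, and the
  correction is invisible in \<open>D h D\<close> because \<open>D D = 0\<close>.\<close>

lemma contraction_from_inner_inverse:
  fixes D g :: "'a::comm_ring_1 mat"
  assumes c: "D \<in> carrier_mat n n" "g \<in> carrier_mat n n" and DD: "D * D = 0\<^sub>m n n"
    and DgD: "D * g * D = D"
  defines "h \<equiv> g * D * g - g * D * g * (g * D * g) * D"
  shows "h \<in> carrier_mat n n" "D * h * D = D" "h * D * h = h" "h * h = 0\<^sub>m n n"
proof -
  note d = carrier_matD[OF c(1)] carrier_matD[OF c(2)]
  have r: "D * (g * D) = D" using DgD d by (simp add: mat_ring)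
  note rw = r mat_rewr3[OF r] DD mat_rewr2[OF DD]
  show "h \<in> carrier_mat n n" by (rule carrier_matI) (use d in \<open>simp_all add: h_def\<close>)
  show "D * h * D = D" "h * D * h = h" "h * h = 0\<^sub>m n n" unfolding h_def using d
    by (simp add: mat_ring rw; auto intro!: eq_matI simp del: index_mult_mat(1))+
qed

lemma homotopy_idempotent:
  fixes D h :: "'a::comm_ring_1 mat"
  assumes c: "D \<in> carrier_mat n n" "h \<in> carrier_mat n n" and DD: "D * D = 0\<^sub>m n n"
    and hDh: "h * D * h = h" and hh: "h * h = 0\<^sub>m n n"
  shows "(1\<^sub>m n - D * h - h * D) * (1\<^sub>m n - D * h - h * D) = 1\<^sub>m n - D * h - h * D"
proof -
  note d = carrier_matD[OF c(1)] carrier_matD[OF c(2)]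
  have r: "h * (D * h) = h" using hDh d by (simp add: mat_ring)
  note rw = r mat_rewr3[OF r] DD mat_rewr2[OF DD] hh mat_rewr2[OF hh]
  show ?thesis using d
    by (simp add: mat_ring rw; auto intro!: eq_matI simp del: index_mult_mat(1))
qed

section \<open>Degrees of matrices\<close>

lemma sum_nonzeroE:
  fixes f :: "'b \<Rightarrow> 'a::comm_monoid_add"
  assumes "(\<Sum>x\<in>A. f x) \<noteq> 0" obtains x where "x \<in> A" "f x \<noteq> 0"
  using assms by (meson sum.neutral)

lemma index_mult_mat_sum:
  "a < dim_row A \<Longrightarrow> b < dim_col B \<Longrightarrow> dim_col A = dim_row B \<Longrightarrow>
    (A * B) $$ (a, b) = (\<Sum>k<dim_row B. A $$ (a, k) * B $$ (k, b))"
  by (simp add: scalar_prod_def atLeast0LessThan)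

lemma homog_mult:
  fixes A B :: "'a::semiring_0 mat"
  assumes A: "homog degT degM e A" and B: "homog degM degS e' B" and d: "dim_col A = dim_row B"
  shows "homog degT degS (e + e') (A * B)"
  unfolding homog_def
proof (intro allI impI)
  fix a b assume ab: "a < dim_row (A * B)" "b < dim_col (A * B)" "(A * B) $$ (a, b) \<noteq> 0"
  then have "(\<Sum>k<dim_row B. A $$ (a, k) * B $$ (k, b)) \<noteq> 0" using d by (simp add: index_mult_mat_sum del: index_mult_mat(1))
  then obtain k where "k < dim_row B" and nz: "A $$ (a, k) * B $$ (k, b) \<noteq> 0" by (blast elim: sum_nonzeroE)
  moreover have "A $$ (a, k) \<noteq> 0" "B $$ (k, b) \<noteq> 0" using nz by auto
  ultimately show "degT a = degS b + (e + e')"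
    using A B ab d by (auto simp: homog_def)
qed

lemma homog_add:
  fixes A B :: "'a::monoid_add mat"
  assumes "homog degT degS e A" "homog degT degS e B" "dim_row A = dim_row B" "dim_col A = dim_col B"
  shows "homog degT degS e (A + B)"
  using assms unfolding homog_def by (auto) (metis add.right_neutral)

lemma homog_diff:
  fixes A B :: "'a::group_add mat"
  assumes "homog degT degS e A" "homog degT degS e B" "dim_row A = dim_row B" "dim_col A = dim_col B"
  shows "homog degT degS e (A - B)"
  using assms unfolding homog_def by (auto) (metis diff_zero)

lemma homog_map:
  "homog degT degS e A \<Longrightarrow> f 0 = 0 \<Longrightarrow> homog degT degS e (map_mat f A)"
  unfolding homog_def by auto metis

lemma homog_one: "homog deg deg 0 (1\<^sub>m n)"
  by (auto simp: homog_def)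

text \<open>Truncation to one degree. It commutes, up to a shift of degree, with multiplication by a
  homogeneous matrix, so an ungraded solution of a linear matrix equation with homogeneous data
  truncates to a graded one.\<close>

definition hpart :: "(nat \<Rightarrow> int) \<Rightarrow> (nat \<Rightarrow> int) \<Rightarrow> int \<Rightarrow> 'a::zero mat \<Rightarrow> 'a mat" where
  "hpart degT degS e M = mat (dim_row M) (dim_col M)
     (\<lambda>(a, b). if degT a = degS b + e then M $$ (a, b) else 0)"

lemma hpart_dim [simp]: "dim_row (hpart degT degS e M) = dim_row M" "dim_col (hpart degT degS e M) = dim_col M"
  by (simp_all add: hpart_def)

lemma hpart_carrier [simp]: "hpart degT degS e M \<in> carrier_mat n m \<longleftrightarrow> M \<in> carrier_mat n m"
  by (metis carrier_matD carrier_matI hpart_dim)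

lemma homog_hpart: "homog degT degS e (hpart degT degS e M)"
  by (auto simp: homog_def hpart_def)

lemma hpart_homog: "homog degT degS e M \<Longrightarrow> hpart degT degS e M = M"
  by (rule eq_matI) (auto simp: homog_def hpart_def)

lemma hpart_mult_left:
  fixes A B :: "'a::semiring_0 mat"
  assumes A: "homog degT degM e A" and d: "dim_col A = dim_row B"
  shows "hpart degT degS (e + e') (A * B) = A * hpart degM degS e' B"
proof (rule eq_matI)
  fix a b assume "a < dim_row (A * hpart degM degS e' B)" "b < dim_col (A * hpart degM degS e' B)"
  then have ab: "a < dim_row A" "b < dim_col B" by auto
  have "A $$ (a, k) * hpart degM degS e' B $$ (k, b) = (if degT a = degS b + (e + e') then A $$ (a, k) * B $$ (k, b) else 0)"
    if "k < dim_row B" for k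
    using A ab that d by (cases "A $$ (a, k) = 0") (auto simp: hpart_def homog_def)
  then show "hpart degT degS (e + e') (A * B) $$ (a, b) = (A * hpart degM degS e' B) $$ (a, b)"
    using ab d by (simp add: index_mult_mat_sum del: index_mult_mat(1)) (simp add: hpart_def index_mult_mat_sum del: index_mult_mat(1))
qed auto

lemma hpart_mult_right:
  fixes A B :: "'a::semiring_0 mat"
  assumes B: "homog degM degS e' B" and d: "dim_col A = dim_row B"
  shows "hpart degT degS (e + e') (A * B) = hpart degT degM e A * B"
proof (rule eq_matI)
  fix a b assume "a < dim_row (hpart degT degM e A * B)" "b < dim_col (hpart degT degM e A * B)"
  then have ab: "a < dim_row A" "b < dim_col B" by auto
  have "hpart degT degM e A $$ (a, k) * B $$ (k, b) = (if degT a = degS b + (e + e') then A $$ (a, k) * B $$ (k, b) else 0)"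
    if "k < dim_row B" for k
    using B ab that d by (cases "B $$ (k, b) = 0") (auto simp: hpart_def homog_def)
  then show "hpart degT degS (e + e') (A * B) $$ (a, b) = (hpart degT degM e A * B) $$ (a, b)"
    using ab d by (simp add: index_mult_mat_sum del: index_mult_mat(1)) (simp add: hpart_def index_mult_mat_sum del: index_mult_mat(1))
qed auto

text \<open>The degree 0 component of \<open>B\<close> is again a right inverse of \<open>A\<close>,
  and inverses are unique.\<close>

lemma homog_inverse:
  fixes A B :: "'a::semiring_1 mat"
  assumes A: "homog deg deg 0 A" and c: "A \<in> carrier_mat n n" "B \<in> carrier_mat n n"
    and AB: "A * B = 1\<^sub>m n" and BA: "B * A = 1\<^sub>m n"
  shows "homog deg deg 0 B"
proof -
  have "A * hpart deg deg 0 B = hpart deg deg (0 + 0) (A * B)"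
    by (rule hpart_mult_left[OF A, symmetric]) (use c in auto)
  also have "\<dots> = 1\<^sub>m n" unfolding AB by (simp add: hpart_homog homog_one)
  finally have "B * (A * hpart deg deg 0 B) = B" using c by simp
  then have "hpart deg deg 0 B = B" using c by (simp add: mat_rewr2[OF BA] mat_ring)
  then show ?thesis using homog_hpart by metis
qed

lemma homog_inner_inverse:
  fixes D g :: "'a::comm_ring_1 mat"
  assumes D: "homog deg deg 1 D" and c: "D \<in> carrier_mat n n" "g \<in> carrier_mat n n" 
    and DgD: "D * g * D = D"
  shows "D * hpart deg deg (-1) g * D = D"
proof -
  have 1: "D * hpart deg deg (-1) g = hpart deg deg (1 + -1) (D * g)"
    by (rule hpart_mult_left[OF D, symmetric]) (use c in auto)
  have "D * hpart deg deg (-1) g * D = hpart deg deg ((1 + -1) + 1) (D * g * D)"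
    unfolding 1 by (rule hpart_mult_right[OF D, symmetric]) (use c in auto)
  then show ?thesis using hpart_homog[OF D] by (simp add: DgD)
qed

section \<open>Traces\<close>

definition tr :: "'a::comm_monoid_add mat \<Rightarrow> 'a" where
  "tr A = (\<Sum>i<dim_row A. A $$ (i, i))"

lemma tr_commute:
  fixes A B :: "'a::comm_semiring_0 mat"
  assumes "A \<in> carrier_mat n m" "B \<in> carrier_mat m n"
  shows "tr (A * B) = tr (B * A)"
proof -
  have "tr (A * B) = (\<Sum>i<n. \<Sum>k<m. A $$ (i, k) * B $$ (k, i))"
    unfolding tr_def using assms by (auto intro!: sum.cong simp: index_mult_mat_sum simp del: index_mult_mat(1))
  also have "\<dots> = (\<Sum>k<m. \<Sum>i<n. A $$ (i, k) * B $$ (k, i))" by (rule sum.swap)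
  also have "\<dots> = tr (B * A)"
    unfolding tr_def using assms by (auto intro!: sum.cong simp: index_mult_mat_sum mult.commute simp del: index_mult_mat(1))
  finally show ?thesis .
qed

lemma tr_diff: "A \<in> carrier_mat n n \<Longrightarrow> B \<in> carrier_mat n n \<Longrightarrow> tr (A - B :: 'a::ab_group_add mat) = tr A - tr B"
  by (simp add: tr_def sum_subtractf)

lemma tr_one: "tr (1\<^sub>m n) = of_nat n"
  by (simp add: tr_def)

section \<open>Contractions of complex differentials\<close>

text \<open>Rank-nullity, in the form needed to evaluate \<open>hom_dim\<close>, whose subtraction
  of naturals is truncated.\<close>

lemma kernel_dim_plus_rank:
  fixes A :: "'a::field mat"
  assumes A: "A \<in> carrier_mat n m"
  shows "kernel_dim A + vec_space.rank n A = m"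
proof -
  interpret K: kernel n m A by unfold_locales (rule A)
  interpret W: vec_space "TYPE('a)" n .
  interpret L: linear_map class_ring "module_vec TYPE('a) m" "module_vec TYPE('a) n" "\<lambda>v. A *\<^sub>v v"
  proof (unfold_locales)
    show "(*\<^sub>v) A \<in> LinearCombinations.module_hom class_ring (module_vec TYPE('a) m) (module_vec TYPE('a) n)"
      using A by (auto simp: LinearCombinations.module_hom_def module_vec_simps
          mult_add_distrib_mat_vec mult_mat_vec)
  qed
  have ker: "L.kerT = mat_kernel A"
    using A by (auto simp: L.ker_def mat_kernel_def module_vec_simps)
  have im: "L.imT = W.span (set (cols A))"
  proof -
    have 1: "L.imT = (\<lambda>v. A *\<^sub>v v) ` carrier_vec m" unfolding L.im_def by (simp only: module_vec_simps)
    have 2: "W.span (set (cols A)) = {y \<in> carrier_vec n. \<exists>x\<in>carrier_vec m. A *\<^sub>v x = y}"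
      using W.col_space_eq[OF A] unfolding W.col_space_def carrier_matD[OF A] .
    show ?thesis unfolding 1 2 using mult_mat_vec_carrier[OF A] by auto
  qed
  have "W.rank A + K.dim = m"
    using L.rank_nullity[OF K.NC.fin_dim] by (simp add: ker im W.rank_def K.NC.dim_is_n)
  then show ?thesis by simp
qed

text \<open>With \<open>b\<close> the conjugate transpose of \<open>a\<close>, the Gram matrix
  \<open>b * a\<close> is invertible: \<open>b a v = 0\<close> makes the Hermitian norm of
  \<open>a v\<close> zero. Its adjugate then yields the left inverse.\<close>

lemma left_inverse_exists:
  fixes a :: "complex mat"
  assumes a: "a \<in> carrier_mat n r"
    and inj: "\<And>v. v \<in> carrier_vec r \<Longrightarrow> a *\<^sub>v v = 0\<^sub>v n \<Longrightarrow> v = 0\<^sub>v r"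
  shows "\<exists>a'\<in>carrier_mat r n. a' * a = 1\<^sub>m r"
proof -
  define b where "b = map_mat cnj (transpose_mat a)"
  have b: "b \<in> carrier_mat r n" using a by (simp add: b_def)
  have G: "b * a \<in> carrier_mat r r" using a b by simp
  have "det (b * a) \<noteq> 0"
  proof
    assume "det (b * a) = 0"
    then obtain v where v: "v \<in> carrier_vec r" "v \<noteq> 0\<^sub>v r" "(b * a) *\<^sub>v v = 0\<^sub>v r"
      using det_0_iff_vec_prod_zero_field[OF G] by blast
    define w where "w = a *\<^sub>v v"
    have w: "w \<in> carrier_vec n" using a v by (simp add: w_def)
    have bw: "b *\<^sub>v w = 0\<^sub>v r" using v a b by (simp add: w_def)
    interpret cnj: semiring_hom cnj by unfold_locales auto
    have cw: "map_vec cnj w = map_mat cnj a *\<^sub>v map_vec cnj v"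
      unfolding w_def by (rule cnj.mult_mat_vec_hom[OF a v(1)])
    have "w \<bullet> map_vec cnj w = (transpose_mat (map_mat cnj a) *\<^sub>v w) \<bullet> map_vec cnj v"
      unfolding cw by (rule transpose_vec_mult_scalar[symmetric]) (use a v w in auto)
    also have "transpose_mat (map_mat cnj a) = b" by (simp add: b_def map_mat_transpose)
    also have "(b *\<^sub>v w) \<bullet> map_vec cnj v = 0" unfolding bw using v by simp
    finally have "w \<bullet>c w = 0" by (simp add: conjugate_vec_def map_vec_def conjugate_complex_def)
    then have "w = 0\<^sub>v n" using conjugate_square_eq_0_vec[OF w] by simp
    then show False using inj[OF v(1)] v(2) by (simp add: w_def)
  qed
  then have "(inverse (det (b * a)) \<cdot>\<^sub>m (adj_mat (b * a) * b)) * a = 1\<^sub>m r"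
    using a b adj_mat[OF G] by (simp add: mat_ring) (auto intro!: eq_matI)
  moreover have "inverse (det (b * a)) \<cdot>\<^sub>m (adj_mat (b * a) * b) \<in> carrier_mat r n"
    using adj_mat(1)[OF G] b by simp
  ultimately show ?thesis by blast
qed

text \<open>The columns of \<open>a\<close> are a maximal independent set of columns of
  \<open>A\<close>, \<open>b\<close> holds the coordinates of all columns in terms of them, and
  \<open>s\<close> selects the chosen ones, \<open>A s = a\<close>. The index map \<open>J\<close>
  is exported so that degrees can be read off when \<open>A\<close> is homogeneous.\<close>

lemma full_rank_factorization:
  fixes A :: "complex mat"
  assumes A: "A \<in> carrier_mat n m"
  obtains a b a' s J where
    "a \<in> carrier_mat n (vec_space.rank n A)" "b \<in> carrier_mat (vec_space.rank n A) m"
    "a' \<in> carrier_mat (vec_space.rank n A) n" "s \<in> carrier_mat m (vec_space.rank n A)"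
    "A = a * b" "a' * a = 1\<^sub>m (vec_space.rank n A)" "b * s = 1\<^sub>m (vec_space.rank n A)"
    "\<And>l. l < vec_space.rank n A \<Longrightarrow> J l < m \<and> col a l = col A (J l)"
proof -
  interpret W: vec_space "TYPE(complex)" n .
  define \<rho> where "\<rho> = W.rank A"
  have cA: "set (cols A) \<subseteq> carrier_vec n" using A cols_dim by blast
  obtain S where S: "finite S" "maximal S (\<lambda>T. T \<subseteq> set (cols A) \<and> W.lin_indpt T)"
    using maximal_exists_superset[of "set (cols A)" "\<lambda>T. T \<subseteq> set (cols A) \<and> W.lin_indpt T" "{}"]
      W.finite_lin_indpt2[of "{}"] by auto
  have SA: "S \<subseteq> set (cols A)" and li: "W.lin_indpt S" using S(2) by (auto simp: maximal_def)
  have Sc: "S \<subseteq> carrier_vec n" using SA cA by blast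
  have card: "card S = \<rho>" using W.rank_card_indpt[OF A S(2)] by (simp add: \<rho>_def)
  obtain vs where vs: "set vs = S" "distinct vs" using finite_distinct_list[OF S(1)] by blast
  have len: "length vs = \<rho>" using vs card distinct_card by fastforce
  define a where "a = mat_of_cols n vs"
  have a: "a \<in> carrier_mat n \<rho>" by (simp add: a_def len[symmetric])
  have cols_a: "cols a = vs" using vs Sc by (simp add: a_def)
  have "\<exists>j<m. vs ! l = col A j" if "l < \<rho>" for l
  proof -
    have "vs ! l \<in> set (cols A)" using that len vs SA by (metis nth_mem subsetD)
    then show ?thesis using A by (auto simp: in_set_conv_nth)
  qed
  then obtain J where J: "\<And>l. l < \<rho> \<Longrightarrow> J l < m \<and> vs ! l = col A (J l)" by metis
  have cola: "col a l = col A (J l)" if "l < \<rho>" for l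
    using J[OF that] that cols_a len by (metis cols_length cols_nth)
  have "\<exists>x\<in>carrier_vec \<rho>. a *\<^sub>v x = col A j" if j: "j < m" for j
  proof -
    have cj: "col A j \<in> set (cols A)" using A j by (auto simp: cols_def)
    have "col A j \<in> W.span S"
    proof (cases "col A j \<in> S")
      case True
      then show ?thesis using Sc W.span_mem by blast
    next
      case False
      then have "W.lin_dep (insert (col A j) S)"
        using S(2) cj SA unfolding maximal_def by (metis insertI1 insert_subset subset_insertI)
      then show ?thesis using W.lin_dep_iff_in_span[OF Sc li _ False] cj cA by auto
    qed
    then show ?thesis using W.col_space_eq[OF a] a by (auto simp: W.col_space_def cols_a vs)
  qed
  then obtain x where x: "\<And>j. j < m \<Longrightarrow> x j \<in> carrier_vec \<rho> \<and> a *\<^sub>v x j = col A j" by metis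
  define b where "b = mat \<rho> m (\<lambda>(l, j). x j $ l)"
  have b: "b \<in> carrier_mat \<rho> m" by (simp add: b_def)
  have colb: "col b j = x j" if "j < m" for j
    using x[OF that] that by (auto simp: b_def)
  have Aab: "A = a * b"
  proof (rule mat_col_eqI)
    fix j assume "j < dim_col (a * b)"
    then have "j < m" using b by simp
    then show "col A j = col (a * b) j" using col_mult2[OF a b, of j] x colb by simp
  qed (use A a b in auto)
  have "\<exists>a'\<in>carrier_mat \<rho> n. a' * a = 1\<^sub>m \<rho>"
  proof (rule left_inverse_exists[OF a])
    fix v :: "complex vec" assume v: "v \<in> carrier_vec \<rho>" "a *\<^sub>v v = 0\<^sub>v n"
    show "v = 0\<^sub>v \<rho>"
      using W.lin_depI[OF a v(1) _ v(2)] li by (auto simp: cols_a vs)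
  qed
  then obtain a' where a': "a' \<in> carrier_mat \<rho> n" "a' * a = 1\<^sub>m \<rho>" by blast
  define s where "s = mat m \<rho> (\<lambda>(j, l). if j = J l then 1 else (0::complex))"
  have s: "s \<in> carrier_mat m \<rho>" by (simp add: s_def)
  have As: "A * s = a"
  proof (rule eq_matI)
    fix i l assume "i < dim_row a" "l < dim_col a"
    then have il: "i < n" "l < \<rho>" using a by auto
    have "(A * s) $$ (i, l) = (\<Sum>k<m. A $$ (i, k) * s $$ (k, l))"
      using il A s by (subst index_mult_mat_sum) auto
    also have "\<dots> = (\<Sum>k<m. if k = J l then A $$ (i, J l) else 0)"
      using il by (intro sum.cong) (auto simp: s_def)
    also have "\<dots> = A $$ (i, J l)" using J[OF il(2)] by simp
    also have "\<dots> = col A (J l) $ i" using il A J[OF il(2)] by simp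
    also have "\<dots> = a $$ (i, l)" using cola[OF il(2)] il a by (metis carrier_matD index_col)
    finally show "(A * s) $$ (i, l) = a $$ (i, l)" .
  qed (use A s a in auto)
  have "b * s = a' * (a * (b * s))" using a b s a' by (simp add: mat_rewr2[OF a'(2)] mat_ring)
  also have "a * (b * s) = a" using As a b s by (simp add: Aab mat_ring)
  also have "a' * a = 1\<^sub>m \<rho>" by (rule a')
  finally have bs: "b * s = 1\<^sub>m \<rho>" .
  show ?thesis
    by (rule that[of a b a' s J, folded \<rho>_def]) (use a b a' s Aab bs J cola in auto)
qed

text \<open>From \<open>a b a b = a b\<close>, cancelling \<open>a\<close> on the left and
  \<open>b\<close> on the right leaves \<open>b a = 1\<close>. Columns of \<open>a\<close> are
  columns of \<open>P\<close>, hence homogeneous if \<open>P\<close> has degree 0, and the degree of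
  the column's index becomes the degree of the new basis vector.\<close>

lemma idempotent_splitting:
  fixes P :: "complex mat"
  assumes P: "P \<in> carrier_mat n n" and PP: "P * P = P"
  obtains r degH i p where "i \<in> carrier_mat n r" "p \<in> carrier_mat r n" "i * p = P" "p * i = 1\<^sub>m r"
    "homog deg deg 0 P \<Longrightarrow> homog deg degH 0 i \<and> homog degH deg 0 p"
proof -
  define r where "r = vec_space.rank n P"
  obtain a b a' s J where f: "a \<in> carrier_mat n r" "b \<in> carrier_mat r n"
    "a' \<in> carrier_mat r n" "s \<in> carrier_mat n r" "P = a * b" "a' * a = 1\<^sub>m r" "b * s = 1\<^sub>m r"
    "\<And>l. l < r \<Longrightarrow> J l < n \<and> col a l = col P (J l)"
    using full_rank_factorization[OF P, folded r_def] by metis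
  note d = carrier_matD[OF f(1)] carrier_matD[OF f(2)] carrier_matD[OF f(3)] carrier_matD[OF f(4)]
  have "b * a = a' * (a * (b * (a * (b * s))))" using d by (simp add: f mat_rewr2[OF f(6)] mat_ring)
  also have "a * (b * (a * (b * s))) = P * P * s" using d by (simp add: f(5) mat_ring)
  also have "\<dots> = a * (b * s)" unfolding PP using d by (simp add: f(5) mat_ring)
  also have "a' * \<dots> = 1\<^sub>m r" using d by (simp add: f mat_ring)
  finally have ba: "b * a = 1\<^sub>m r" .
  have "homog deg (\<lambda>l. deg (J l)) 0 a \<and> homog (\<lambda>l. deg (J l)) deg 0 b" if h: "homog deg deg 0 P"
  proof
    show ha: "homog deg (\<lambda>l. deg (J l)) 0 a" unfolding homog_def
    proof (intro allI impI)
      fix x l assume xl: "x < dim_row a" "l < dim_col a" "a $$ (x, l) \<noteq> 0"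
      then have "x < n" "l < r" using d by auto
      moreover from this have "a $$ (x, l) = P $$ (x, J l)" using f(8)[of l] d P by (metis carrier_matD index_col)
      ultimately show "deg x = deg (J l) + 0" using h xl f(8)[of l] P by (auto simp: homog_def)
    qed
    \<comment> \<open>The left inverse \<open>a'\<close> need not be homogeneous, so
      \<open>b\<close> is compared with its own degree 0 component: both have the same product with
      \<open>a\<close>, which can be cancelled.\<close>
    have "a * hpart (\<lambda>l. deg (J l)) deg 0 b = hpart deg deg (0 + 0) (a * b)"
      by (rule hpart_mult_left[OF ha, symmetric]) (use d in auto)
    also have "\<dots> = a * b" using hpart_homog[OF h] by (simp add: f(5))
    finally have "a' * (a * hpart (\<lambda>l. deg (J l)) deg 0 b) = a' * (a * b)" by simp
    then have "hpart (\<lambda>l. deg (J l)) deg 0 b = b" using d by (simp add: mat_rewr2[OF f(6)] mat_ring)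
    then show "homog (\<lambda>l. deg (J l)) deg 0 b" using homog_hpart by metis
  qed
  with that[of a r b "\<lambda>l. deg (J l)"] f(1,2,5) ba show ?thesis by auto
qed

text \<open>The trace counts the size \<open>r\<close> of the splitting, faithfully in
  characteristic 0.\<close>

lemma idempotent_trace_zero:
  fixes P :: "complex mat"
  assumes P: "P \<in> carrier_mat n n" and PP: "P * P = P" and t: "tr P = 0"
  shows "P = 0\<^sub>m n n"
proof -
  obtain r degH i p where s: "i \<in> carrier_mat n r" "p \<in> carrier_mat r n" "i * p = P" "p * i = 1\<^sub>m r"
    using idempotent_splitting[OF P PP] by metis
  have "tr P = of_nat r" using tr_commute[OF s(1,2)] by (simp add: s tr_one)
  then have "r = 0" using t by simp
  then show ?thesis using s by (intro eq_matI) (auto simp: s(3)[symmetric] scalar_prod_def)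
qed

text \<open>Compare the traces of \<open>i * p\<close> and \<open>p * i\<close>. The count applies
  in particular to evaluations at nearby points, before \<open>D h D = D\<close> is known
  there.\<close>

lemma splitting_dimension:
  fixes D :: "complex mat"
  assumes c: "D \<in> carrier_mat n n" "h \<in> carrier_mat n n" "i \<in> carrier_mat n r" "p \<in> carrier_mat r n"
    and ip: "i * p = 1\<^sub>m n - D * h - h * D" and pi: "p * i = 1\<^sub>m r"
  shows "of_nat n = of_nat r + 2 * tr (D * h)"
proof -
  have "tr (i * p) = of_nat r" using tr_commute[OF c(3,4)] by (simp add: pi tr_one)
  moreover have "tr (i * p) = of_nat n - tr (D * h) - tr (h * D)"
  proof -
    have "1\<^sub>m n - D * h \<in> carrier_mat n n" by (rule carrier_matI) (use c in auto)
    then show ?thesis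
      unfolding ip using mult_carrier_mat[OF c(1,2)] mult_carrier_mat[OF c(2,1)] by (simp add: tr_diff[of _ n] tr_one)
  qed
  ultimately show ?thesis using tr_commute[OF c(1,2)] by (simp add: algebra_simps)
qed

text \<open>With \<open>D = a b\<close> of full rank, \<open>D h D = D\<close> forces
  \<open>b h a = 1\<close>, so \<open>tr (D * h)\<close> is the rank of \<open>D\<close>.
  Rank-nullity then identifies \<open>r\<close> with the dimension of the homology.\<close>

lemma splitting_hom_dim:
  fixes D :: "complex mat"
  assumes c: "D \<in> carrier_mat n n" "h \<in> carrier_mat n n" "i \<in> carrier_mat n r" "p \<in> carrier_mat r n"
    and ip: "i * p = 1\<^sub>m n - D * h - h * D" and pi: "p * i = 1\<^sub>m r" and DhD: "D * h * D = D"
  shows "r = hom_dim D" "n = r + 2 * vec_space.rank n D"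
proof -
  define \<rho> where "\<rho> = vec_space.rank n D"
  obtain a b a' s J where f: "a \<in> carrier_mat n \<rho>" "b \<in> carrier_mat \<rho> n"
    "a' \<in> carrier_mat \<rho> n" "s \<in> carrier_mat n \<rho>" "D = a * b" "a' * a = 1\<^sub>m \<rho>" "b * s = 1\<^sub>m \<rho>"
    using full_rank_factorization[OF c(1), folded \<rho>_def] by metis
  note d = carrier_matD[OF f(1)] carrier_matD[OF f(2)] carrier_matD[OF f(3)] carrier_matD[OF f(4)]
     carrier_matD[OF c(2)]
  have "b * h * a = a' * (a * (b * (h * (a * (b * s)))))" using d by (simp add: f mat_rewr2[OF f(6)] mat_ring)
  also have "a * (b * (h * (a * (b * s)))) = D * h * D * s" using d by (simp add: f(5) mat_ring)
  also have "\<dots> = a * (b * s)" unfolding DhD using d by (simp add: f(5) mat_ring)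
  also have "a' * \<dots> = 1\<^sub>m \<rho>" using d by (simp add: f mat_ring)
  finally have bha: "b * h * a = 1\<^sub>m \<rho>" .
  have "tr (D * h) = tr (a * (b * h))" using d by (simp add: f(5) mat_ring)
  also have "\<dots> = tr (b * h * a)" by (rule tr_commute) (use f c in auto)
  finally have "tr (D * h) = of_nat \<rho>" by (simp add: bha tr_one)
  with splitting_dimension[OF c ip pi] have "(of_nat n :: complex) = of_nat (r + 2 * \<rho>)" by simp
  then have n: "n = r + 2 * \<rho>" by (simp only: of_nat_eq_iff)
  then show "n = r + 2 * vec_space.rank n D" by (simp add: \<rho>_def)
  have "hom_dim D = kernel_dim D - \<rho>" unfolding hom_dim_def \<rho>_def carrier_matD[OF c(1)] ..
  with kernel_dim_plus_rank[OF c(1)] n show "r = hom_dim D" unfolding \<rho>_def by linarith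
qed

lemma inner_inverse_exists:
  fixes D :: "complex mat"
  assumes c: "D \<in> carrier_mat n n"
  obtains g where "g \<in> carrier_mat n n" "D * g * D = D" "homog deg deg 1 D \<Longrightarrow> homog deg deg (-1) g"
proof -
  define \<rho> where "\<rho> = vec_space.rank n D"
  obtain a b a' s J where f: "a \<in> carrier_mat n \<rho>" "b \<in> carrier_mat \<rho> n"
    "a' \<in> carrier_mat \<rho> n" "s \<in> carrier_mat n \<rho>" "D = a * b" "a' * a = 1\<^sub>m \<rho>" "b * s = 1\<^sub>m \<rho>"
    using full_rank_factorization[OF c, folded \<rho>_def] by metis
  note d = carrier_matD[OF f(1)] carrier_matD[OF f(2)] carrier_matD[OF f(3)] carrier_matD[OF f(4)]
  have g: "s * a' \<in> carrier_mat n n" "D * (s * a') * D = D" using f d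
    by (auto simp: f(5) mat_ring mat_rewr2[OF f(6)] mat_rewr2[OF f(7)])
  show ?thesis
  proof (cases "homog deg deg 1 D")
    case True
    show ?thesis
      by (rule that[of "hpart deg deg (-1) (s * a')"])
        (use g homog_inner_inverse[OF True c g] in \<open>auto intro: homog_hpart\<close>)
  next
    case False
    then show ?thesis using that g by blast
  qed
qed

lemma contraction_exists:
  fixes D :: "complex mat"
  assumes c: "D \<in> carrier_mat n n" and DD: "D * D = 0\<^sub>m n n"
  obtains h where "h \<in> carrier_mat n n" "D * h * D = D" "h * D * h = h" "h * h = 0\<^sub>m n n"
     "homog deg deg 1 D \<Longrightarrow> homog deg deg (-1) h"
proof -
  obtain g where g: "g \<in> carrier_mat n n" "D * g * D = D" "homog deg deg 1 D \<Longrightarrow> homog deg deg (-1) g"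
    using inner_inverse_exists[OF c] by metis
  let ?h = "g * D * g - g * D * g * (g * D * g) * D"
  have "homog deg deg (-1) ?h" if D: "homog deg deg 1 D"
  proof -
    have 1: "homog deg deg (- 1 + 1 + - 1) (g * D * g)"
      by (rule homog_mult[OF homog_mult[OF g(3)[OF D] D] g(3)[OF D]]) (use g c in auto)
    have "homog deg deg ((- 1 + 1 + - 1) + (- 1 + 1 + - 1) + 1) (g * D * g * (g * D * g) * D)"
      by (rule homog_mult[OF homog_mult[OF 1 1] D]) (use g c in auto)
    with 1 show ?thesis by (intro homog_diff) (use g c in auto)
  qed
  with that contraction_from_inner_inverse[OF c g(1) DD g(2)] show ?thesis by blast
qed

lemma homog_projection:
  fixes D h :: "complex mat"
  assumes "homog deg deg 1 D" "homog deg deg (-1) h" "D \<in> carrier_mat n n" "h \<in> carrier_mat n n"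
  shows "homog deg deg 0 (1\<^sub>m n - D * h - h * D)"
proof -
  have "homog deg deg 0 (D * h)" "homog deg deg 0 (h * D)"
    using homog_mult[OF assms(1,2)] homog_mult[OF assms(2,1)] assms by auto
  then show ?thesis by (intro homog_diff homog_one) (use assms in auto)
qed

text \<open>Supplies admissible values of \<open>h\<close>, \<open>i\<close>, \<open>p\<close> at
  \<open>q\<close>. The equation for \<open>n\<close> is kept because it shows that the truncated
  subtraction in \<open>hom_dim\<close> loses nothing when \<open>D D = 0\<close>;
  \<open>contraction_maximal\<close> relies on it.\<close>

lemma hodge_decomposition:
  fixes D :: "complex mat"
  assumes c: "D \<in> carrier_mat n n" and DD: "D * D = 0\<^sub>m n n"
  obtains degH h i p where
    "h \<in> carrier_mat n n" "i \<in> carrier_mat n (hom_dim D)" "p \<in> carrier_mat (hom_dim D) n"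
    "h * h = 0\<^sub>m n n" "h * D * h = h" "i * p = 1\<^sub>m n - D * h - h * D" "p * i = 1\<^sub>m (hom_dim D)" "D * h * D = D"
    "n = hom_dim D + 2 * vec_space.rank n D"
    "homog deg deg 1 D \<Longrightarrow> homog deg deg (-1) h \<and> homog deg degH 0 i \<and> homog degH deg 0 p"
proof -
  obtain h where h: "h \<in> carrier_mat n n" "D * h * D = D" "h * D * h = h" "h * h = 0\<^sub>m n n"
     "homog deg deg 1 D \<Longrightarrow> homog deg deg (-1) h"
    using contraction_exists[OF c DD] by metis
  have P: "1\<^sub>m n - D * h - h * D \<in> carrier_mat n n" by (rule carrier_matI) (use c h in auto)
  obtain r degH i p where s: "i \<in> carrier_mat n r" "p \<in> carrier_mat r n" "i * p = 1\<^sub>m n - D * h - h * D"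
     "p * i = 1\<^sub>m r"
    "homog deg deg 0 (1\<^sub>m n - D * h - h * D) \<Longrightarrow> homog deg degH 0 i \<and> homog degH deg 0 p"
    using idempotent_splitting[OF P homotopy_idempotent[OF c h(1) DD h(3,4)], of deg] by metis
  have r: "r = hom_dim D" "n = r + 2 * vec_space.rank n D"
    using splitting_hom_dim[OF c h(1) s(1,2,3,4) h(2)] by auto
  have "homog deg deg (-1) h \<and> homog deg degH 0 i \<and> homog degH deg 0 p" if D: "homog deg deg 1 D"
    using s(5) homog_projection[OF D h(5)[OF D] c h(1)] h(5)[OF D] by blast
  with h s r show ?thesis using that[of h i p degH] by auto
qed

text \<open>Writing \<open>D = a b\<close> with factors of full rank, \<open>b h a\<close> is an idempotent whose trace equals its size.\<close>
lemma contraction_maximal: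
  fixes D :: "complex mat"
  assumes c: "D \<in> carrier_mat n n" "h \<in> carrier_mat n n" 
    "i \<in> carrier_mat n (hom_dim D)" "p \<in> carrier_mat (hom_dim D) n"
    and DD: "D * D = 0\<^sub>m n n" and hDh: "h * D * h = h"
    and ip: "i * p = 1\<^sub>m n - D * h - h * D" and pi: "p * i = 1\<^sub>m (hom_dim D)"
  shows "D * h * D = D"
proof -
  define \<rho> where "\<rho> = vec_space.rank n D"
  have n: "n = hom_dim D + 2 * \<rho>"
    using hodge_decomposition[OF c(1) DD] unfolding \<rho>_def by metis
  obtain a b a' s J where f: "a \<in> carrier_mat n \<rho>" "b \<in> carrier_mat \<rho> n"
    "a' \<in> carrier_mat \<rho> n" "s \<in> carrier_mat n \<rho>" "D = a * b" "a' * a = 1\<^sub>m \<rho>" "b * s = 1\<^sub>m \<rho>"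
    using full_rank_factorization[OF c(1), folded \<rho>_def] by metis
  note d = carrier_matD[OF f(1)] carrier_matD[OF f(2)] carrier_matD[OF f(3)] carrier_matD[OF f(4)]
     carrier_matD[OF c(2)]
  define X where "X = b * h * a"
  have X: "X \<in> carrier_mat \<rho> \<rho>" unfolding X_def using f c by auto
  have "X * X = b * (h * D * h) * a" unfolding X_def using d by (simp add: f(5) mat_ring)
  then have XX: "X * X = X" by (simp add: hDh X_def)
  have "tr (D * h) = tr (a * (b * h))" using d by (simp add: f(5) mat_ring)
  also have "\<dots> = tr X" unfolding X_def by (rule tr_commute) (use f c in auto)
  finally have "of_nat n = of_nat (hom_dim D) + 2 * tr X"
    using splitting_dimension[OF c ip pi] by simp
  moreover have "(of_nat n :: complex) = of_nat (hom_dim D) + 2 * of_nat \<rho>"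
    using arg_cong[OF n, of "of_nat :: nat \<Rightarrow> complex"] by simp
  ultimately have "tr X = of_nat \<rho>" by simp
  then have "tr (1\<^sub>m \<rho> - X) = 0" using X by (subst tr_diff[of _ \<rho>]) (auto simp: tr_one)
  moreover have "(1\<^sub>m \<rho> - X) * (1\<^sub>m \<rho> - X) = 1\<^sub>m \<rho> - X"
    using X by (simp add: mat_ring XX; auto intro!: eq_matI)
  ultimately have "1\<^sub>m \<rho> - X = 0\<^sub>m \<rho> \<rho>" using X by (intro idempotent_trace_zero) auto
  then have "X = 1\<^sub>m \<rho>" using X by (auto simp: mat_eq_iff)
  moreover have "D * h * D = a * X * b" unfolding X_def using d by (simp add: f(5) mat_ring)
  ultimately show ?thesis using f d by (simp add: mat_ring)
qed

text \<open>For \<open>P = 1 - D h - h D\<close>, the image of \<open>P\<close> consists of cycles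
  as \<open>D P = 0\<close>. By exactness these are boundaries, which \<open>P\<close> kills as
  \<open>P D = 0\<close>; so \<open>P = P P = 0\<close>.\<close>

lemma exact_contraction:
  fixes D :: "complex mat"
  assumes c: "D \<in> carrier_mat n n" and DD: "D * D = 0\<^sub>m n n"
    and exact: "\<And>x. x \<in> carrier_vec n \<Longrightarrow> D *\<^sub>v x = 0\<^sub>v n \<Longrightarrow> \<exists>y\<in>carrier_vec n. x = D *\<^sub>v y"
  obtains h where "h \<in> carrier_mat n n" "D * h * D = D" "h * D * h = h" "h * h = 0\<^sub>m n n" "1\<^sub>m n - D * h - h * D = 0\<^sub>m n n"
     "homog deg deg 1 D \<Longrightarrow> homog deg deg (-1) h"
proof -
  obtain h where h: "h \<in> carrier_mat n n" "D * h * D = D" "h * D * h = h" "h * h = 0\<^sub>m n n"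
     "homog deg deg 1 D \<Longrightarrow> homog deg deg (-1) h"
    using contraction_exists[OF c DD] by metis
  note d = carrier_matD[OF c] carrier_matD[OF h(1)]
  define P where "P = 1\<^sub>m n - D * h - h * D"
  have P: "P \<in> carrier_mat n n" unfolding P_def by (rule carrier_matI) (use c h in auto)
  have PP: "P * P = P" unfolding P_def by (rule homotopy_idempotent[OF c h(1) DD h(3,4)])
  have r: "D * (h * D) = D" using h(2) d by (simp add: mat_ring)
  have DP: "D * P = 0\<^sub>m n n" unfolding P_def using d
    by (simp add: mat_ring r mat_rewr2[OF DD]; auto intro!: eq_matI)
  have PD: "P * D = 0\<^sub>m n n" unfolding P_def using d
    by (simp add: mat_ring r DD; auto intro!: eq_matI)
  have Pv: "P *\<^sub>v v = 0\<^sub>v n" if v: "v \<in> carrier_vec n" for v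
  proof -
    have "D *\<^sub>v (P *\<^sub>v v) = (D * P) *\<^sub>v v" using c P v by simp
    also have "\<dots> = 0\<^sub>v n" unfolding DP using v by (intro eq_vecI) (auto simp: scalar_prod_def)
    finally obtain y where y: "y \<in> carrier_vec n" "P *\<^sub>v v = D *\<^sub>v y" using exact[of "P *\<^sub>v v"] P v by auto
    have "P *\<^sub>v v = (P * P) *\<^sub>v v" by (simp add: PP)
    also have "\<dots> = P *\<^sub>v (D *\<^sub>v y)" using P v y by simp
    also have "\<dots> = (P * D) *\<^sub>v y" using P c y by simp
    also have "\<dots> = 0\<^sub>v n" unfolding PD using y by (intro eq_vecI) (auto simp: scalar_prod_def)
    finally show ?thesis .
  qed
  have "P = 0\<^sub>m n n"
  proof (intro eq_matI)
    fix i j assume "i < dim_row (0\<^sub>m n n)" "j < dim_col (0\<^sub>m n n)"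
    then have ij: "i < n" "j < n" by auto
    then show "P $$ (i, j) = 0\<^sub>m n n $$ (i, j)"
      using arg_cong[OF Pv[of "unit_vec n j"], of "\<lambda>w. w $ i"] P by simp
  qed (use P in auto)
  with h that[of h] show ?thesis by (simp add: P_def)
qed

section \<open>Rational functions regular at a point\<close>

interpretation rf_hom: inj_comm_ring_hom "rf :: 'v::linorder mpoly \<Rightarrow> 'v rfun"
  by unfold_locales (auto simp: rf_def One_fract_def Zero_fract_def eq_fract)

lemma Fract_eq_rf: "Fract a b = rf a / rf b"
  by (simp add: rf_def)

lemma rval_rf [intro]: "rval k (rf p :: 'v::{finite,linorder} rfun) (mpeval p k)"
  unfolding rval_def rf_def by (intro exI[of _ p] exI[of _ 1]) simp

lemma mpeval_nonzero: "mpeval b k \<noteq> 0 \<Longrightarrow> (b :: 'v::finite mpoly) \<noteq> 0"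
  by auto

lemma rval_unique:
  fixes r :: "'v::{finite,linorder} rfun"
  assumes "rval k r c" "rval k r c'" shows "c = c'"
proof -
  obtain a b where 1: "r = Fract a b" "mpeval b k \<noteq> 0" "c = mpeval a k / mpeval b k"
    using assms(1) by (auto simp: rval_def)
  obtain a' b' where 2: "r = Fract a' b'" "mpeval b' k \<noteq> 0" "c' = mpeval a' k / mpeval b' k"
    using assms(2) unfolding rval_def by blast
  note * = 1 2
  have "a * b' = a' * b" using * by (metis eq_fract(1) mpeval_nonzero)
  then have "mpeval a k * mpeval b' k = mpeval a' k * mpeval b k" by (metis mpeval_mult)
  then show ?thesis using * by (simp add: frac_eq_eq)
qed

lemma rval_add:
  fixes r r' :: "'v::{finite,linorder} rfun"
  assumes "rval k r c" "rval k r' c'" shows "rval k (r + r') (c + c')"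
proof -
  obtain a b a' b' where *: "r = Fract a b" "mpeval b k \<noteq> 0" "c = mpeval a k / mpeval b k"
    "r' = Fract a' b'" "mpeval b' k \<noteq> 0" "c' = mpeval a' k / mpeval b' k"
    using assms by (auto simp: rval_def)
  then show ?thesis unfolding rval_def
    by (intro exI[of _ "a * b' + a' * b"] exI[of _ "b * b'"]) (auto simp: mpeval_nonzero field_simps)
qed

lemma rval_mult:
  fixes r r' :: "'v::{finite,linorder} rfun"
  assumes "rval k r c" "rval k r' c'" shows "rval k (r * r') (c * c')"
proof -
  obtain a b a' b' where *: "r = Fract a b" "mpeval b k \<noteq> 0" "c = mpeval a k / mpeval b k"
    "r' = Fract a' b'" "mpeval b' k \<noteq> 0" "c' = mpeval a' k / mpeval b' k"
    using assms by (auto simp: rval_def)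
  then show ?thesis unfolding rval_def
    by (intro exI[of _ "a * a'"] exI[of _ "b * b'"]) auto
qed

lemma rval_cst [intro]: "rval k (rf (cst c) :: 'v::{finite,linorder} rfun) c"
  using rval_rf[of k "cst c"] by simp

lemma rval_diff:
  fixes r r' :: "'v::{finite,linorder} rfun"
  assumes "rval k r c" "rval k r' c'" shows "rval k (r - r') (c - c')"
  using rval_add[OF assms(1) rval_mult[OF rval_cst[of k "-1"] assms(2)]]
  by (simp add: cst_hom.hom_uminus rf_hom.hom_uminus)

lemma rval_0 [intro]: "rval k (0 :: 'v::{finite,linorder} rfun) 0"
  using rval_cst[of k 0] by simp

lemma rval_1 [intro]: "rval k (1 :: 'v::{finite,linorder} rfun) 1"
  using rval_cst[of k 1] by simp

lemma rval_sum:
  fixes f :: "'b \<Rightarrow> 'v::{finite,linorder} rfun"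
  shows "(\<And>x. x \<in> A \<Longrightarrow> rval k (f x) (g x)) \<Longrightarrow> rval k (\<Sum>x\<in>A. f x) (\<Sum>x\<in>A. g x)"
  by (induction A rule: infinite_finite_induct) (auto intro: rval_add)

lemma rval_inverse_rf:
  fixes p :: "'v::{finite,linorder} mpoly"
  assumes "mpeval p k \<noteq> 0" shows "rval k (inverse (rf p)) (inverse (mpeval p k))"
  unfolding rval_def rf_def using assms
  by (intro exI[of _ 1] exI[of _ p]) (auto simp: divide_inverse)

lemma mat_val_regular: "mat_val_at k M M0 \<Longrightarrow> mat_regular_at k M"
  by (auto simp: mat_val_at_def mat_regular_at_def)

lemma mat_val_unique:
  fixes M :: "'v::{finite,linorder} rfun mat"
  assumes "mat_val_at k M A" "mat_val_at k M B" shows "A = B"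
proof (rule eq_matI)
  fix i j assume "i < dim_row B" "j < dim_col B"
  then show "A $$ (i, j) = B $$ (i, j)"
    using assms by (auto simp: mat_val_at_def intro: rval_unique[of k "M $$ (i, j)"])
qed (use assms in \<open>auto simp: mat_val_at_def\<close>)

lemma mat_val_mult:
  fixes A B :: "'v::{finite,linorder} rfun mat"
  assumes "mat_val_at k A A0" "mat_val_at k B B0" "dim_col A = dim_row B"
  shows "mat_val_at k (A * B) (A0 * B0)"
  using assms unfolding mat_val_at_def
  by (auto simp: index_mult_mat_sum simp del: index_mult_mat(1) intro!: rval_sum rval_mult)

lemma mat_val_add:
  fixes A B :: "'v::{finite,linorder} rfun mat"
  assumes "mat_val_at k A A0" "mat_val_at k B B0" "dim_row A = dim_row B" "dim_col A = dim_col B"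
  shows "mat_val_at k (A + B) (A0 + B0)"
  using assms unfolding mat_val_at_def by (auto intro!: rval_add)

lemma mat_val_diff:
  fixes A B :: "'v::{finite,linorder} rfun mat"
  assumes "mat_val_at k A A0" "mat_val_at k B B0" "dim_row A = dim_row B" "dim_col A = dim_col B"
  shows "mat_val_at k (A - B) (A0 - B0)"
  using assms unfolding mat_val_at_def by (auto intro!: rval_diff)

lemma mat_val_smult:
  fixes A :: "'v::{finite,linorder} rfun mat"
  assumes "rval k r c" "mat_val_at k A A0"
  shows "mat_val_at k (r \<cdot>\<^sub>m A) (c \<cdot>\<^sub>m A0)"
  using assms unfolding mat_val_at_def by (auto intro!: rval_mult)

lemma mat_val_one: "mat_val_at k (1\<^sub>m n :: 'v::{finite,linorder} rfun mat) (1\<^sub>m n)"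
  unfolding mat_val_at_def by auto

lemma mat_val_zero: "mat_val_at k (0\<^sub>m n m :: 'v::{finite,linorder} rfun mat) (0\<^sub>m n m)"
  unfolding mat_val_at_def by auto

lemma mat_val_rf: "mat_val_at k (map_mat rf N :: 'v::{finite,linorder} rfun mat) (eval_mat N k)"
  unfolding mat_val_at_def eval_mat_def by auto

text \<open>Constant matrices over the function field. The values at \<open>q\<close> become
  unperturbed data there, to which \<open>perturbation\<close> applies.\<close>

definition cmat :: "complex mat \<Rightarrow> 'v::linorder rfun mat" where
  "cmat M = map_mat (\<lambda>c. rf (cst c)) M"

lemma cmat_dim [simp]: "dim_row (cmat M) = dim_row M" "dim_col (cmat M) = dim_col M"
  by (simp_all add: cmat_def)

lemma mat_val_cmat: "mat_val_at k (cmat M :: 'v::{finite,linorder} rfun mat) M"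
  unfolding mat_val_at_def cmat_def by auto

interpretation rfcst_hom: comm_ring_hom "\<lambda>c. rf (cst c) :: 'v::{finite,linorder} rfun"
  by unfold_locales (auto simp: cst_hom.hom_add cst_hom.hom_mult rf_hom.hom_add rf_hom.hom_mult)

lemma cmat_mult:
  assumes "dim_col A = dim_row B"
  shows "(cmat (A * B) :: 'v::{finite,linorder} rfun mat) = cmat A * cmat B"
  unfolding cmat_def
  by (rule rfcst_hom.mat_hom_mult[of A "dim_row A" "dim_row B" B "dim_col B"]) (use assms in auto)

lemma cmat_diff:
  assumes "dim_row A = dim_row B" "dim_col A = dim_col B"
  shows "(cmat (A - B) :: 'v::{finite,linorder} rfun mat) = cmat A - cmat B"
  unfolding cmat_def by (rule eq_matI) (use assms in \<open>auto simp: cst_hom.hom_minus rf_hom.hom_minus\<close>)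

lemma cmat_one: "(cmat (1\<^sub>m n) :: 'v::{finite,linorder} rfun mat) = 1\<^sub>m n"
  unfolding cmat_def by (rule eq_matI) auto

lemma cmat_zero: "(cmat (0\<^sub>m n m) :: 'v::{finite,linorder} rfun mat) = 0\<^sub>m n m"
  unfolding cmat_def by (rule eq_matI) auto

lemma homog_cmat: "homog degT degS e M \<Longrightarrow> homog degT degS e (cmat M :: 'v::{finite,linorder} rfun mat)"
  unfolding cmat_def by (rule homog_map) auto

lemma homog_mat_val:
  fixes M :: "'v::{finite,linorder} rfun mat"
  assumes "homog degT degS e M" "mat_val_at k M M0"
  shows "homog degT degS e M0"
  using assms unfolding homog_def mat_val_at_def
  by auto (metis rval_0 rval_unique)

text \<open>Clearing denominators leads back to polynomial matrices, whose determinants can be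
  evaluated and for which directional derivatives are defined.\<close>

lemma common_denominator:
  fixes M :: "'v::{finite,linorder} rfun mat"
  assumes M: "mat_val_at q M M0"
  obtains g N where "mpeval g q \<noteq> 0" "N \<in> carrier_mat (dim_row M) (dim_col M)"
    "rf g \<cdot>\<^sub>m M = map_mat rf N" "eval_mat N q = mpeval g q \<cdot>\<^sub>m M0"
proof -
  let ?I = "{..<dim_row M} \<times> {..<dim_col M}"
  have "\<forall>x\<in>?I. \<exists>a b. M $$ x = Fract a b \<and> mpeval b q \<noteq> 0"
    using M unfolding mat_val_at_def rval_def by (auto; metis)
  then obtain a b where ab: "\<And>x. x \<in> ?I \<Longrightarrow> M $$ x = Fract (a x) (b x) \<and> mpeval (b x) q \<noteq> 0" by metis
  define g where "g = (\<Prod>x\<in>?I. b x)"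
  define N where "N = mat (dim_row M) (dim_col M) (\<lambda>x. a x * (\<Prod>y\<in>?I - {x}. b y))"
  have g: "mpeval g q \<noteq> 0" unfolding g_def mpeval_hom.hom_prod using ab by (simp add: prod_zero_iff)
  have N: "N \<in> carrier_mat (dim_row M) (dim_col M)" by (simp add: N_def)
  have gM: "rf g \<cdot>\<^sub>m M = map_mat rf N"
  proof (rule eq_matI)
    fix i j assume "i < dim_row (map_mat rf N)" "j < dim_col (map_mat rf N)"
    then have ij: "(i, j) \<in> ?I" by (auto simp: N_def)
    have b0: "rf (b (i, j)) \<noteq> 0" using ab[OF ij] mpeval_nonzero by (metis rf_hom.hom_0_iff)
    have "g = b (i, j) * (\<Prod>y\<in>?I - {(i, j)}. b y)" unfolding g_def by (rule prod.remove) (use ij in auto)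
    moreover have "M $$ (i, j) = rf (a (i, j)) / rf (b (i, j))" using ab[OF ij] by (simp add: Fract_eq_rf)
    ultimately have "rf g * M $$ (i, j) = rf (a (i, j) * (\<Prod>y\<in>?I - {(i, j)}. b y))"
      using b0 by (simp add: rf_hom.hom_mult)
    then show "(rf g \<cdot>\<^sub>m M) $$ (i, j) = map_mat rf N $$ (i, j)" using ij by (simp add: N_def)
  qed (auto simp: N_def)
  have "mat_val_at q (map_mat rf N) (mpeval g q \<cdot>\<^sub>m M0)"
    unfolding gM[symmetric] by (rule mat_val_smult[OF rval_rf M])
  then have "eval_mat N q = mpeval g q \<cdot>\<^sub>m M0" by (rule mat_val_unique[OF mat_val_rf])
  with that g N gM show ?thesis by blast
qed

text \<open>Cramer's rule for \<open>N = g M\<close>: the inverse of \<open>M\<close> is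
  \<open>g / det N\<close> times the adjugate of \<open>N\<close>. The single polynomial
  \<open>v = det N\<close> controls regularity at all points, not only at \<open>q\<close>.\<close>

lemma regular_inverse:
  fixes M :: "'v::{finite,linorder} rfun mat"
  assumes M: "M \<in> carrier_mat n n" "mat_val_at q M M0" and M0: "det M0 \<noteq> 0"
  obtains B v where "B \<in> carrier_mat n n" "M * B = 1\<^sub>m n" "B * M = 1\<^sub>m n" "mpeval v q \<noteq> 0"
    "\<And>k. mpeval v k \<noteq> 0 \<Longrightarrow> \<exists>Bk. mat_val_at k B Bk"
proof -
  obtain g N where g: "mpeval g q \<noteq> 0" "N \<in> carrier_mat (dim_row M) (dim_col M)"
    "rf g \<cdot>\<^sub>m M = map_mat rf N" "eval_mat N q = mpeval g q \<cdot>\<^sub>m M0"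
    using common_denominator[OF M(2)] .
  have N: "N \<in> carrier_mat n n" using g(2) M by simp
  define v where "v = det N"
  have "mpeval v q = det (eval_mat N q)" by (simp add: v_def eval_mat_def)
  also have "\<dots> \<noteq> 0" unfolding g(4) using g(1) M0 by (simp add: det_smult)
  finally have v: "mpeval v q \<noteq> 0" .
  then have v0: "rf v \<noteq> 0" using mpeval_nonzero by (metis rf_hom.hom_0_iff)
  have g0: "rf g \<noteq> 0" using g(1) mpeval_nonzero by (metis rf_hom.hom_0_iff)
  have M_eq: "M = inverse (rf g) \<cdot>\<^sub>m map_mat rf N"
    unfolding g(3)[symmetric] using g0 by (auto intro!: eq_matI)
  define B where "B = (rf g * inverse (rf v)) \<cdot>\<^sub>m map_mat rf (adj_mat N)"
  note adj = adj_mat[OF N]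
  have B: "B \<in> carrier_mat n n" using adj by (simp add: B_def)
  have vI: "map_mat rf (v \<cdot>\<^sub>m 1\<^sub>m n) = rf v \<cdot>\<^sub>m 1\<^sub>m n" by (rule eq_matI) (auto simp: rf_hom.hom_mult)
  have 1: "map_mat rf N * map_mat rf (adj_mat N) = rf v \<cdot>\<^sub>m 1\<^sub>m n"
    using rf_hom.mat_hom_mult[OF N adj(1)] unfolding adj(2) v_def[symmetric] vI by simp
  have 2: "map_mat rf (adj_mat N) * map_mat rf N = rf v \<cdot>\<^sub>m 1\<^sub>m n"
    using rf_hom.mat_hom_mult[OF adj(1) N] unfolding adj(3) v_def[symmetric] vI by simp
  have cancel: "inverse (rf g) * (rf g * inverse (rf v) * (rf v * x)) = x"
    "rf g * inverse (rf v) * (inverse (rf g) * (rf v * x)) = x" for x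
    using v0 g0 by (simp_all add: field_simps)
  have "M * B = 1\<^sub>m n" "B * M = 1\<^sub>m n"
    unfolding M_eq B_def using carrier_matD[OF N] carrier_matD[OF adj(1)]
    by (simp_all add: mat_ring 1 2) (rule eq_matI; simp add: cancel)+
  moreover have "\<exists>Bk. mat_val_at k B Bk" if "mpeval v k \<noteq> 0" for k
    unfolding B_def using mat_val_smult[OF rval_mult[OF rval_rf rval_inverse_rf[OF that]] mat_val_rf] by blast
  ultimately show ?thesis using that B v by blast
qed

text \<open>The values of \<open>f\<close> are known only where \<open>v\<close> is nonzero.
  Multiplying the numerator by the denominator and by \<open>v\<close> makes it vanish on all of
  \<open>Q = 0\<close>, as \<open>local_nullstellensatz\<close> requires; the extra factors are
  nonzero at \<open>q\<close> and move into the denominator.\<close>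

lemma divisible_if_vanishing:
  fixes Q :: "'v::{finite,linorder} mpoly"
  assumes q: "mpeval Q q = 0" and xi: "mpdir Q q xi \<noteq> 0"
    and f: "rval q f c" and v: "mpeval v q \<noteq> 0"
    and van: "\<And>k. mpeval Q k = 0 \<Longrightarrow> mpeval v k \<noteq> 0 \<Longrightarrow> rval k f 0"
  obtains f' c' where "rval q f' c'" "f = rf Q * f'"
proof -
  obtain S where S: "mpeval S q \<noteq> 0" 
    "\<And>F. (\<And>k. mpeval Q k = 0 \<Longrightarrow> mpeval F k = 0) \<Longrightarrow> Q dvd S * F"
    using local_nullstellensatz[OF q xi] by blast
  obtain a b where ab: "f = Fract a b" "mpeval b q \<noteq> 0" using f by (auto simp: rval_def)
  have "mpeval (a * b * v) k = 0" if "mpeval Q k = 0" for k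
  proof (cases "mpeval v k = 0 \<or> mpeval b k = 0")
    case False
    then have "rval k f (mpeval a k / mpeval b k)" by (auto simp: rval_def ab)
    with van[OF that] False have "mpeval a k / mpeval b k = 0" using rval_unique by blast
    then show ?thesis using False by simp
  qed auto
  then obtain w where w: "S * (a * b * v) = Q * w" using S(2)[of "a * b * v"] by blast
  \<comment> \<open>One \<open>b\<close> comes from the multiplied numerator, the other is the
    denominator of \<open>f\<close> itself.\<close>
  define f' where "f' = Fract w (S * b * v * b)"
  have nz: "mpeval (S * b * v * b) q \<noteq> 0" using S ab v by simp
  have "rval q f' (mpeval w q / mpeval (S * b * v * b) q)"
    unfolding rval_def f'_def using nz by blast
  moreover have "f = rf Q * f'"
  proof -
    have "b \<noteq> 0" "S * b * v * b \<noteq> 0" using ab(2) nz mpeval_nonzero by blast+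
    moreover have "a * (S * b * v * b) = (Q * w) * b" by (simp add: w[symmetric] mult_ac)
    ultimately show ?thesis unfolding ab f'_def rf_def by (simp add: eq_fract)
  qed
  ultimately show ?thesis using that by blast
qed

lemma zariski_open_basic:
  assumes "zariski_open U" "q \<in> U"
  obtains u where "mpeval u q \<noteq> 0" "\<And>k. mpeval u k \<noteq> 0 \<Longrightarrow> k \<in> U"
  using assms unfolding zariski_open_def by blast

section \<open>The local structure of the differential\<close>

lemma eval_mat_dim [simp]: "dim_row (eval_mat M k) = dim_row M" "dim_col (eval_mat M k) = dim_col M"
  by (simp_all add: eval_mat_def)

lemma dir_mat_dim [simp]: "dim_row (dir_mat M q xi) = dim_row M" "dim_col (dir_mat M q xi) = dim_col M"
  by (simp_all add: dir_mat_def)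

lemma eval_mat_mult:
  fixes A B :: "'v::finite mpoly mat"
  assumes "dim_col A = dim_row B"
  shows "eval_mat (A * B) k = eval_mat A k * eval_mat B k"
  unfolding eval_mat_def
  by (rule mpeval_hom.mat_hom_mult[of A "dim_row A" "dim_row B" B "dim_col B"]) (use assms in auto)

lemma eval_mat_cst: "eval_mat (map_mat cst M :: 'v::finite mpoly mat) k = M"
  unfolding eval_mat_def by (rule eq_matI) auto

lemma eval_mat_diff:
  fixes A B :: "'v::finite mpoly mat"
  assumes "dim_row A = dim_row B" "dim_col A = dim_col B"
  shows "eval_mat (A - B) k = eval_mat A k - eval_mat B k"
  unfolding eval_mat_def by (rule eq_matI) (use assms in \<open>auto simp: mpeval_hom.hom_minus\<close>)

lemma mpdir_diff: "mpdir (p - p' :: 'v::finite mpoly) q xi = mpdir p q xi - mpdir p' q xi"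
  using mpdir_add[of "p - p'" p' q xi] by simp

lemma dir_mat_mult:
  fixes A B :: "'v::finite mpoly mat"
  assumes "dim_col A = dim_row B"
  shows "dir_mat (A * B) q xi = dir_mat A q xi * eval_mat B q + eval_mat A q * dir_mat B q xi"
  by (rule eq_matI)
    (use assms in \<open>auto simp: dir_mat_def eval_mat_def index_mult_mat_sum mpdir_sum mpdir_mult sum.distrib
      simp del: index_mult_mat(1)\<close>)

lemma dir_mat_smult:
  fixes M :: "'v::finite mpoly mat"
  shows "dir_mat (g \<cdot>\<^sub>m M) q xi = mpdir g q xi \<cdot>\<^sub>m eval_mat M q + mpeval g q \<cdot>\<^sub>m dir_mat M q xi"
  by (rule eq_matI) (auto simp: dir_mat_def eval_mat_def mpdir_mult)

lemma dir_mat_diff: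
  fixes A B :: "'v::finite mpoly mat"
  assumes "dim_row A = dim_row B" "dim_col A = dim_col B"
  shows "dir_mat (A - B) q xi = dir_mat A q xi - dir_mat B q xi"
  by (rule eq_matI) (use assms in \<open>auto simp: dir_mat_def mpdir_diff\<close>)

lemma dir_mat_cst: "dir_mat (map_mat cst M :: 'v::finite mpoly mat) q xi = 0\<^sub>m (dim_row M) (dim_col M)"
  by (rule eq_matI) (auto simp: dir_mat_def)

lemma rf_mat_mult:
  fixes A B :: "'v::linorder mpoly mat"
  assumes "dim_col A = dim_row B"
  shows "map_mat rf (A * B) = map_mat rf A * map_mat rf B"
  by (rule rf_hom.mat_hom_mult[of A "dim_row A" "dim_row B" B "dim_col B"]) (use assms in auto)

lemma rf_mat_smult: "map_mat rf (g \<cdot>\<^sub>m M) = rf g \<cdot>\<^sub>m map_mat rf M"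
  by (rule eq_matI) (auto simp: rf_hom.hom_mult)

lemma rf_mat_diff:
  fixes A B :: "'v::linorder mpoly mat"
  assumes "dim_row A = dim_row B" "dim_col A = dim_col B"
  shows "map_mat rf (A - B) = map_mat rf A - map_mat rf B"
  by (rule eq_matI) (use assms in \<open>auto simp: rf_hom.hom_minus\<close>)

lemma cmat_eq_rf: "cmat M = map_mat rf (map_mat cst M)"
  by (rule eq_matI) (auto simp: cmat_def)

text \<open>Stated for any regular differential because it is used twice: for \<open>d\<close> with
  the chosen contraction at \<open>q\<close>, and for \<open>d'\<close> with a contraction onto
  dimension 0. The polynomial \<open>v\<close> cuts out the neighbourhood of \<open>q\<close> on
  which \<open>h\<close>, \<open>i\<close>, \<open>p\<close> have values.\<close>

lemma regular_perturbation:
  fixes D :: "'v::{finite,linorder} rfun mat"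
  assumes D: "D \<in> carrier_mat n n" and DD: "D * D = 0\<^sub>m n n" and val: "mat_val_at q D D0"
    and c: "h0 \<in> carrier_mat n n" "i0 \<in> carrier_mat n r" "p0 \<in> carrier_mat r n"
    and hh: "h0 * h0 = 0\<^sub>m n n" and hDh: "h0 * D0 * h0 = h0"
    and ip: "i0 * p0 = 1\<^sub>m n - D0 * h0 - h0 * D0" and pi: "p0 * i0 = 1\<^sub>m r"
    and DhD: "D0 * h0 * D0 = D0"
  obtains h i p v where "h \<in> carrier_mat n n" "i \<in> carrier_mat n r" "p \<in> carrier_mat r n"
    "h * h = 0\<^sub>m n n" "h * D * h = h" "i * p = 1\<^sub>m n - D * h - h * D" "p * i = 1\<^sub>m r"
    "mat_val_at q h h0" "mat_val_at q i i0" "mat_val_at q p p0"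
    "p * D * i = cmat p0 * ((D - cmat D0) - (D - cmat D0) * h * (D - cmat D0)) * cmat i0"
    "mpeval v q \<noteq> 0"
    "\<forall>k Dk. mpeval v k \<noteq> 0 \<and> mat_val_at k D Dk \<longrightarrow>
       (\<exists>hk ik pk. mat_val_at k h hk \<and> mat_val_at k i ik \<and> mat_val_at k p pk)"
    "\<forall>degC degH. homog degC degC 1 D \<and> homog degC degC (-1) h0 \<and> homog degC degH 0 i0 \<and>
       homog degH degC 0 p0 \<longrightarrow> homog degC degC (-1) h \<and> homog degC degH 0 i \<and> homog degH degC 0 p"
proof -
  have D0: "D0 \<in> carrier_mat n n" using val D by (auto simp: mat_val_at_def)
  define E where "E = D - cmat D0"
  have E: "E \<in> carrier_mat n n" unfolding E_def by (rule carrier_matI) (use D D0 in auto)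
  have D_eq: "cmat D0 + E = D" unfolding E_def using D D0 by (auto intro!: eq_matI)
  note d = carrier_matD[OF D] carrier_matD[OF D0] carrier_matD[OF E] carrier_matD[OF c(1)]
    carrier_matD[OF c(2)] carrier_matD[OF c(3)]
  have valE: "mat_val_at q E (0\<^sub>m n n)"
  proof -
    have "D0 - D0 = 0\<^sub>m n n" using D0 by (auto intro!: eq_matI)
    then show ?thesis using mat_val_diff[OF val mat_val_cmat[of q D0]] d by (simp add: E_def)
  qed
  have DD0: "D0 * D0 = 0\<^sub>m n n"
    using mat_val_unique[OF mat_val_mult[OF val val]] mat_val_zero[of q n n] d by (simp add: DD)
  \<comment> \<open>\<open>E\<close> vanishes at \<open>q\<close>, so \<open>M\<close> is the
    identity there and has an inverse \<open>B\<close> regular at \<open>q\<close>.\<close>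
  define M where "M = 1\<^sub>m n + E * cmat h0"
  have M: "M \<in> carrier_mat n n" unfolding M_def by (rule carrier_matI) (use d in auto)
  have valM: "mat_val_at q M (1\<^sub>m n)"
  proof -
    have "mat_val_at q M (1\<^sub>m n + 0\<^sub>m n n * h0)" unfolding M_def
      by (intro mat_val_add mat_val_mult mat_val_one valE mat_val_cmat) (use d in auto)
    then show ?thesis using d by (simp add: mat_ring)
  qed
  obtain B v where B: "B \<in> carrier_mat n n" "M * B = 1\<^sub>m n" "B * M = 1\<^sub>m n" "mpeval v q \<noteq> 0"
    "\<And>k. mpeval v k \<noteq> 0 \<Longrightarrow> \<exists>Bk. mat_val_at k B Bk"
    using regular_inverse[OF M valM] by (metis det_one one_neq_zero)
  note d = d carrier_matD[OF B(1)] carrier_matD[OF M]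
  have EhB: "E * (cmat h0 * B) = 1\<^sub>m n - B"
    unfolding B(2)[symmetric] unfolding M_def using d
    by (simp add: mat_ring) (rule eq_matI; simp del: index_mult_mat(1))
  have BEh: "B * (E * cmat h0) = 1\<^sub>m n - B"
    unfolding B(3)[symmetric] unfolding M_def using d
    by (simp add: mat_ring) (rule eq_matI; simp del: index_mult_mat(1))
  define h where "h = cmat h0 * B"
  define i where "i = cmat i0 - h * E * cmat i0"
  define p where "p = cmat p0 - cmat p0 * E * h"
  have h: "h \<in> carrier_mat n n" unfolding h_def by (rule carrier_matI) (use d in auto)
  note d = d carrier_matD[OF h]
  have i: "i \<in> carrier_mat n r" unfolding i_def by (rule carrier_matI) (use d in auto)
  have p: "p \<in> carrier_mat r n" unfolding p_def by (rule carrier_matI) (use d in auto)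
  note d = d carrier_matD[OF i] carrier_matD[OF p]
  have ca: "cmat D0 \<in> carrier_mat n n" "cmat h0 \<in> carrier_mat n n" "cmat i0 \<in> carrier_mat n r"
      "cmat p0 \<in> carrier_mat r n" by (rule carrier_matI; use d in simp)+
  have 1: "cmat D0 * cmat D0 = (0\<^sub>m n n :: 'v rfun mat)" using d by (simp add: cmat_mult[symmetric] DD0 cmat_zero)
  have 2: "(cmat D0 + E) * (cmat D0 + E) = 0\<^sub>m n n" unfolding D_eq by (rule DD)
  have 3: "cmat h0 * cmat h0 = (0\<^sub>m n n :: 'v rfun mat)" using d by (simp add: cmat_mult[symmetric] hh cmat_zero)
  have 4: "cmat h0 * cmat D0 * cmat h0 = (cmat h0 :: 'v rfun mat)" using d by (simp add: cmat_mult[symmetric] hDh)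
  have 5: "cmat i0 * cmat p0 = 1\<^sub>m n - cmat D0 * cmat h0 - cmat h0 * (cmat D0 :: 'v rfun mat)"
    using d by (simp add: cmat_mult[symmetric] cmat_diff[symmetric] cmat_one[symmetric] ip)
  have 6: "cmat p0 * cmat i0 = (1\<^sub>m r :: 'v rfun mat)" using d by (simp add: cmat_mult[symmetric] pi cmat_one)
  have 7: "cmat D0 * cmat h0 * cmat D0 = (cmat D0 :: 'v rfun mat)" using d by (simp add: cmat_mult[symmetric] DhD)
  have 8: "cmat h0 * (E * h) = cmat h0 - h"
    unfolding h_def EhB using d by (simp add: mat_ring)
  have 9: "h * (E * cmat h0) = cmat h0 - h"
    unfolding h_def using d by (simp add: mat_assoc BEh) (simp add: mat_ring)
  note pert = perturbation[OF ca(1) E ca(2-4) h 1 2 3 4 5 6 7 8 9 i_def p_def, unfolded D_eq]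
  have valh: "mat_val_at q h h0"
  proof -
    obtain Bq where Bq: "mat_val_at q B Bq" using B(4,5) by blast
    have "mat_val_at q (M * B) (1\<^sub>m n * Bq)" by (rule mat_val_mult[OF valM Bq]) (use d in auto)
    then have "1\<^sub>m n * Bq = 1\<^sub>m n" unfolding B(2) using mat_val_unique mat_val_one by blast
    moreover have "Bq \<in> carrier_mat n n" using Bq d by (auto simp: mat_val_at_def)
    ultimately have "Bq = 1\<^sub>m n" by simp
    then have "mat_val_at q h (h0 * 1\<^sub>m n)" unfolding h_def using mat_val_mult[OF mat_val_cmat Bq] d by simp
    then show ?thesis using c by simp
  qed
  have vali: "mat_val_at q i i0"
  proof -
    have "mat_val_at q i (i0 - h0 * 0\<^sub>m n n * i0)" unfolding i_def
      by (intro mat_val_diff mat_val_mult mat_val_cmat valh valE) (use d in auto)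
    also have "i0 - h0 * 0\<^sub>m n n * i0 = i0" using d by (simp add: mat_ring) (auto intro!: eq_matI)
    finally show ?thesis .
  qed
  have valp: "mat_val_at q p p0"
  proof -
    have "mat_val_at q p (p0 - p0 * 0\<^sub>m n n * h0)" unfolding p_def
      by (intro mat_val_diff mat_val_mult mat_val_cmat valh valE) (use d in auto)
    also have "p0 - p0 * 0\<^sub>m n n * h0 = p0" using d by (simp add: mat_ring) (auto intro!: eq_matI)
    finally show ?thesis .
  qed
  have near: "\<exists>hk ik pk. mat_val_at k h hk \<and> mat_val_at k i ik \<and> mat_val_at k p pk"
    if v: "mpeval v k \<noteq> 0" and Dk: "mat_val_at k D Dk" for k Dk
  proof -
    obtain Bk where Bk: "mat_val_at k B Bk" using B(5)[OF v] by blast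
    have hk: "mat_val_at k h (h0 * Bk)" unfolding h_def
      by (rule mat_val_mult[OF mat_val_cmat Bk]) (use d in auto)
    have Ek: "mat_val_at k E (Dk - D0)" unfolding E_def
      by (rule mat_val_diff[OF Dk mat_val_cmat]) (use d in auto)
    have "mat_val_at k i (i0 - (h0 * Bk) * (Dk - D0) * i0)" unfolding i_def
      by (intro mat_val_diff mat_val_mult mat_val_cmat hk Ek) (use d in auto)
    moreover have "mat_val_at k p (p0 - p0 * (Dk - D0) * (h0 * Bk))" unfolding p_def
      by (intro mat_val_diff mat_val_mult mat_val_cmat hk Ek) (use d in auto)
    ultimately show ?thesis using hk by blast
  qed
  have gr: "homog degC degC (-1) h \<and> homog degC degH 0 i \<and> homog degH degC 0 p"
    if D1: "homog degC degC 1 D" and h1: "homog degC degC (-1) h0"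
      and i1: "homog degC degH 0 i0" and p1: "homog degH degC 0 p0" for degC degH
  proof -
    have E1: "homog degC degC 1 E" unfolding E_def
      by (intro homog_diff D1 homog_cmat homog_mat_val[OF D1 val]) (use d in auto)
    have "homog degC degC (1 + -1) (E * cmat h0)"
      by (rule homog_mult[OF E1 homog_cmat[OF h1]]) (use d in auto)
    then have "homog degC degC 0 M" unfolding M_def by (intro homog_add homog_one) (use d in auto)
    then have B1: "homog degC degC 0 B" by (rule homog_inverse[OF _ M B(1,2,3)])
    have "homog degC degC (-1 + 0) h" unfolding h_def
      by (rule homog_mult[OF homog_cmat[OF h1] B1]) (use d in auto)
    then have h2: "homog degC degC (-1) h" by simp
    have "homog degC degH ((-1 + 1) + 0) (h * E * cmat i0)"
      by (rule homog_mult[OF homog_mult[OF h2 E1] homog_cmat[OF i1]]) (use d in auto)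
    then have "homog degC degH 0 i" unfolding i_def by (intro homog_diff homog_cmat i1) (use d in auto)
    moreover have "homog degH degC ((0 + 1) + -1) (cmat p0 * E * h)"
      by (rule homog_mult[OF homog_mult[OF homog_cmat[OF p1] E1] h2]) (use d in auto)
    then have "homog degH degC 0 p" unfolding p_def by (intro homog_diff homog_cmat p1) (use d in auto)
    ultimately show ?thesis using h2 by blast
  qed
  show ?thesis
    by (rule that[OF h i p pert(1-4) valh vali valp pert(5)[unfolded E_def] B(4)]) (use near gr in blast)+
qed

text \<open>\<open>E\<close> vanishes at \<open>q\<close>, so \<open>E h E\<close> vanishes to
  second order and only \<open>p0 E i0\<close> has a first derivative; on the other side
  \<open>Q(q) = 0\<close> leaves \<open>mpdir Q q xi\<close> times the value of \<open>d'\<close>.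
  As \<open>mpdir\<close> acts on polynomials, the denominators of \<open>h\<close> and
  \<open>d'\<close> are cleared first.\<close>

lemma derivative_of_quotient:
  fixes Q :: "'v::{finite,linorder} mpoly"
  assumes d: "d \<in> carrier_mat n n" and Qq: "mpeval Q q = 0"
    and c: "h \<in> carrier_mat n n" "i0 \<in> carrier_mat n r" "p0 \<in> carrier_mat r n" "d' \<in> carrier_mat r r"
    and valh: "mat_val_at q h h0" and vald': "mat_val_at q d' d0"
    and E_def: "E = map_mat rf d - cmat (eval_mat d q)"
    and eq: "rf Q \<cdot>\<^sub>m d' = cmat p0 * (E - E * h * E) * cmat i0"
  shows "mpdir Q q xi \<cdot>\<^sub>m d0 = p0 * dir_mat d q xi * i0"
proof -
  obtain g N where g: "mpeval g q \<noteq> 0" "N \<in> carrier_mat r r"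
    "rf g \<cdot>\<^sub>m d' = map_mat rf N" "eval_mat N q = mpeval g q \<cdot>\<^sub>m d0"
    using common_denominator[OF vald'] c by (metis carrier_matD)
  obtain f M where f: "mpeval f q \<noteq> 0" "M \<in> carrier_mat n n"
    "rf f \<cdot>\<^sub>m h = map_mat rf M"
    using common_denominator[OF valh] c by (metis carrier_matD)
  define e where "e = d - map_mat cst (eval_mat d q)"
  have E_e: "E = map_mat rf e" unfolding E_def e_def cmat_eq_rf using d by (simp add: rf_mat_diff)
  have e: "e \<in> carrier_mat n n" unfolding e_def by (rule carrier_matI) (use d in auto)
  have d0: "d0 \<in> carrier_mat r r" using vald' c by (auto simp: mat_val_at_def)
  have eval_e: "eval_mat e q = 0\<^sub>m n n"
    unfolding e_def using d by (subst eval_mat_diff) (auto simp: eval_mat_cst intro!: eq_matI)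
  have dir_e: "dir_mat e q xi = dir_mat d q xi"
    unfolding e_def using d by (subst dir_mat_diff) (auto simp: dir_mat_cst intro!: eq_matI)
  note dm = carrier_matD[OF d] carrier_matD[OF e] carrier_matD[OF c(1)] carrier_matD[OF c(2)]
    carrier_matD[OF c(3)] carrier_matD[OF c(4)] carrier_matD[OF g(2)] carrier_matD[OF f(2)] carrier_matD[OF d0]
  have E: "dim_row E = n" "dim_col E = n" unfolding E_e using dm by auto
  \<comment> \<open>\<open>g * f\<close> times \<open>E - E h E\<close> in polynomial form; in the
    second term \<open>f\<close> is absorbed by \<open>M\<close>, which represents
    \<open>f h\<close>.\<close>
  let ?X = "(g * f) \<cdot>\<^sub>m e - g \<cdot>\<^sub>m (e * M * e)"
  have "map_mat rf ((Q * f) \<cdot>\<^sub>m N) = (rf g * rf f) \<cdot>\<^sub>m (rf Q \<cdot>\<^sub>m d')"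
    unfolding rf_mat_smult g(3)[symmetric] by (rule eq_matI) (auto simp: rf_hom.hom_mult)
  also have "\<dots> = cmat p0 * ((rf g * rf f) \<cdot>\<^sub>m E - rf g \<cdot>\<^sub>m (E * (rf f \<cdot>\<^sub>m h) * E)) * cmat i0"
    unfolding eq using dm E
    by (simp add: mat_ring) (rule eq_matI; simp add: algebra_simps del: index_mult_mat(1))
  also have "\<dots> = map_mat rf (map_mat cst p0 * ?X * map_mat cst i0)"
    unfolding f(3) E_e cmat_eq_rf using dm
    by (simp add: rf_mat_mult rf_mat_diff rf_mat_smult rf_hom.hom_mult)
  finally have "(Q * f) \<cdot>\<^sub>m N = map_mat cst p0 * ?X * map_mat cst i0"
    by (rule rf_hom.mat_hom_inj)
  from arg_cong[OF this, of "\<lambda>M. dir_mat M q xi"]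
  have "(mpdir Q q xi * mpeval f q) \<cdot>\<^sub>m (mpeval g q \<cdot>\<^sub>m d0) =
      (mpeval g q * mpeval f q) \<cdot>\<^sub>m (p0 * dir_mat d q xi * i0)"
  proof -
    have L: "dir_mat ((Q * f) \<cdot>\<^sub>m N) q xi = (mpdir Q q xi * mpeval f q) \<cdot>\<^sub>m (mpeval g q \<cdot>\<^sub>m d0)"
      unfolding dir_mat_smult mpdir_mult g(4) using Qq dm by (auto intro!: eq_matI)
    have X1: "dir_mat ?X q xi = (mpeval g q * mpeval f q) \<cdot>\<^sub>m dir_mat d q xi"
    proof -
      have "dir_mat (e * M * e) q xi = 0\<^sub>m n n"
        using dm by (simp add: dir_mat_mult eval_mat_mult eval_e mat_ring)
      moreover have "eval_mat (e * M * e) q = 0\<^sub>m n n"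
        using dm by (simp add: eval_mat_mult eval_e mat_ring)
      ultimately show ?thesis using dm
        by (subst dir_mat_diff) (auto simp: dir_mat_smult eval_e dir_e intro!: eq_matI)
    qed
    have X0: "dir_mat (map_mat cst p0 * ?X * map_mat cst i0) q xi = p0 * dir_mat ?X q xi * i0"
      using dm by (subst dir_mat_mult, simp, subst dir_mat_mult, simp)
        (simp add: dir_mat_cst eval_mat_cst mat_ring, auto intro!: eq_matI simp del: index_mult_mat(1))
    assume "dir_mat ((Q * f) \<cdot>\<^sub>m N) q xi = dir_mat (map_mat cst p0 * ?X * map_mat cst i0) q xi"
    then show ?thesis unfolding L X0 X1 using dm by (simp add: mat_ring)
  qed
  then show ?thesis
    using g(1) f(1) dm by (auto simp: mat_eq_iff simp del: index_mult_mat(1))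
qed

text \<open>Exactness is given on representatives and is transferred to the matrix
  \<open>T = p D' i\<close> on homology coordinates. This rests on two facts: \<open>D' i\<close> is
  \<open>i T\<close> up to boundaries (\<open>M1\<close>), and \<open>p D'\<close> agrees with
  \<open>T p\<close> on cycles (\<open>M2\<close>).\<close>

lemma induced_exact_compressed:
  fixes D D' :: "complex mat"
  assumes c: "D \<in> carrier_mat n n" "D' \<in> carrier_mat n n" "h \<in> carrier_mat n n"
      "i \<in> carrier_mat n r" "p \<in> carrier_mat r n"
    and DD: "D * D = 0\<^sub>m n n" and anti: "D * D' = 0\<^sub>m n n - D' * D"
    and ip: "i * p = 1\<^sub>m n - D * h - h * D" and pi: "p * i = 1\<^sub>m r" and DhD: "D * h * D = D"
    and ex: "induced_exact D D'"
    and x: "x \<in> carrier_vec r" "(p * D' * i) *\<^sub>v x = 0\<^sub>v r"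
  shows "\<exists>y\<in>carrier_vec r. x = (p * D' * i) *\<^sub>v y"
proof -
  note d = carrier_matD[OF c(1)] carrier_matD[OF c(2)] carrier_matD[OF c(3)] carrier_matD[OF c(4)] carrier_matD[OF c(5)]
  note cyc = contraction_cycles[OF c(1,3,4,5) DD ip pi DhD]
  define T where "T = p * D' * i"
  have T: "T \<in> carrier_mat r r" unfolding T_def using c by simp
  have one: "1\<^sub>m n = i * p + D * h + h * D"
    unfolding ip using d by (auto intro!: eq_matI simp del: index_mult_mat(1))
  have DDi: "D * (D' * i) = 0\<^sub>m n r"
  proof -
    have "D * (D' * i) = (D * D') * i" using d by (simp add: mat_ring)
    also have "\<dots> = 0\<^sub>m n r" unfolding anti using d by (simp add: mat_ring cyc; auto intro!: eq_matI)
    finally show ?thesis .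
  qed
  have pDD: "p * (D' * D) = 0\<^sub>m r n"
  proof -
    have "D' * D = 0\<^sub>m n n - D * D'" unfolding anti using d by (auto intro!: eq_matI simp del: index_mult_mat(1))
    then have "p * (D' * D) = p * (0\<^sub>m n n - D * D')" by simp
    also have "\<dots> = 0\<^sub>m r n" using d by (simp add: mat_ring mat_rewr2[OF cyc(2)]; auto intro!: eq_matI)
    finally show ?thesis .
  qed
  have "D' * i = 1\<^sub>m n * (D' * i)" using d by (simp add: mat_ring)
  also have "\<dots> = i * T + D * (h * (D' * i))" unfolding one T_def using d
    by (simp add: mat_ring DDi; auto intro!: eq_matI simp del: index_mult_mat(1))
  finally have M1: "D' * i = i * T + D * (h * (D' * i))" .
  have "p * D' = p * (D' * 1\<^sub>m n)" using d by (simp add: mat_ring)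
  also have "\<dots> = T * p + (p * D' * h) * D" unfolding one T_def using d
    by (simp add: mat_ring mat_rewr3[OF pDD]; auto intro!: eq_matI simp del: index_mult_mat(1))
  finally have M2: "p * D' = T * p + (p * D' * h) * D" .
  define X where "X = i *\<^sub>v x"
  define Z where "Z = (h * (D' * i)) *\<^sub>v x"
  have Xc: "X \<in> carrier_vec n" unfolding X_def using c x by simp
  have Zc: "Z \<in> carrier_vec n" unfolding Z_def by (rule carrier_vecI) (use d in simp)
  have "D *\<^sub>v X = (D * i) *\<^sub>v x" unfolding X_def using c x by simp
  also have "\<dots> = 0\<^sub>v n" unfolding cyc using x by (intro eq_vecI) (auto simp: scalar_prod_def)
  finally have DX: "D *\<^sub>v X = 0\<^sub>v n" .
  have "D' *\<^sub>v X = (D' * i) *\<^sub>v x" unfolding X_def using c x by simp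
  also have "\<dots> = (i * T) *\<^sub>v x + (D * (h * (D' * i))) *\<^sub>v x"
    by (subst M1, rule add_mult_distrib_mat_vec[of _ n r]) (use c T x in auto)
  also have "(i * T) *\<^sub>v x = i *\<^sub>v (T *\<^sub>v x)" using c T x by simp
  also have "\<dots> = 0\<^sub>v n" unfolding x(2)[folded T_def] using c by (intro eq_vecI) (auto simp: scalar_prod_def)
  also have "(D * (h * (D' * i))) *\<^sub>v x = D *\<^sub>v Z" unfolding Z_def 
    by (rule assoc_mult_mat_vec[of _ n n _ r]) (use c x in auto)
  finally have "D' *\<^sub>v X = D *\<^sub>v Z" using c Zc by simp
  with ex DX Xc Zc obtain y z where y: "y \<in> carrier_vec n" "D *\<^sub>v y = 0\<^sub>v n" "z \<in> carrier_vec n" 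
    "X - D' *\<^sub>v y = D *\<^sub>v z"
    unfolding induced_exact_def Let_def d(1) by blast
  \<comment> \<open>Apply \<open>p\<close> to \<open>i x = D z + D' y\<close>: the boundary dies,
    and \<open>M2\<close> turns the rest into \<open>T (p y)\<close> because \<open>y\<close> is a
    cycle.\<close>
  have "x = (p * i) *\<^sub>v x" unfolding pi using x by simp
  also have "\<dots> = p *\<^sub>v X" unfolding X_def using c x by simp
  also have "X = D *\<^sub>v z + D' *\<^sub>v y"
    unfolding y(4)[symmetric] using Xc c y(1) by (intro eq_vecI) auto
  also have "p *\<^sub>v (D *\<^sub>v z + D' *\<^sub>v y) = p *\<^sub>v (D *\<^sub>v z) + p *\<^sub>v (D' *\<^sub>v y)"
    by (rule mult_add_distrib_mat_vec) (use c y in auto)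
  also have "p *\<^sub>v (D *\<^sub>v z) = (p * D) *\<^sub>v z" using c y by simp
  also have "\<dots> = 0\<^sub>v r" unfolding cyc using y by (intro eq_vecI) (auto simp: scalar_prod_def)
  also have "p *\<^sub>v (D' *\<^sub>v y) = (p * D') *\<^sub>v y" using c y by simp
  also have "\<dots> = (T * p) *\<^sub>v y + ((p * D' * h) * D) *\<^sub>v y"
    by (subst M2, rule add_mult_distrib_mat_vec[of _ r n]) (use c T y in auto)
  also have "((p * D' * h) * D) *\<^sub>v y = (p * D' * h) *\<^sub>v (D *\<^sub>v y)"
    by (rule assoc_mult_mat_vec[of _ r n _ n]) (use c y in auto)
  also have "\<dots> = 0\<^sub>v r" unfolding y(2) using c by (intro eq_vecI) (auto simp: scalar_prod_def)
  also have "(T * p) *\<^sub>v y = T *\<^sub>v (p *\<^sub>v y)" by (rule assoc_mult_mat_vec[of _ r r _ n]) (use c T y in auto)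
  finally have "x = T *\<^sub>v (p *\<^sub>v y)" using T c y by simp
  moreover have "p *\<^sub>v y \<in> carrier_vec r" using c y by simp
  ultimately show ?thesis unfolding T_def by (rule bexI)
qed

text \<open>The identities between rational functions specialise to \<open>k\<close>. Constancy of
  the homology dimension enters through the sizes of \<open>i\<close> and \<open>p\<close>, which
  are \<open>hom_dim Dk\<close>: by \<open>contraction_maximal\<close> this gives
  \<open>D h D = D\<close> at \<open>k\<close>, hence \<open>D i = 0\<close> there.\<close>

lemma vanishing_on_hypersurface:
  fixes D :: "'v::{finite,linorder} rfun mat"
  assumes c: "D \<in> carrier_mat n n" "h \<in> carrier_mat n n" "i \<in> carrier_mat n (hom_dim Dk)"
      "p \<in> carrier_mat (hom_dim Dk) n"
    and DD: "D * D = 0\<^sub>m n n" and hh: "h * h = 0\<^sub>m n n" and hDh: "h * D * h = h"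
    and ip: "i * p = 1\<^sub>m n - D * h - h * D" and pi: "p * i = 1\<^sub>m (hom_dim Dk)"
    and val: "mat_val_at k D Dk" "mat_val_at k h hk" "mat_val_at k i ik" "mat_val_at k p pk"
  shows "mat_val_at k (p * D * i) (0\<^sub>m (hom_dim Dk) (hom_dim Dk))"
proof -
  let ?r = "hom_dim Dk"
  have ck: "Dk \<in> carrier_mat n n" "hk \<in> carrier_mat n n" "ik \<in> carrier_mat n ?r" "pk \<in> carrier_mat ?r n"
    using val c by (auto simp: mat_val_at_def)
  note d = carrier_matD[OF c(1)] carrier_matD[OF c(2)] carrier_matD[OF c(3)] carrier_matD[OF c(4)]
    carrier_matD[OF ck(1)] carrier_matD[OF ck(2)] carrier_matD[OF ck(3)] carrier_matD[OF ck(4)]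
  have DDk: "Dk * Dk = 0\<^sub>m n n"
    using mat_val_unique[OF mat_val_mult[OF val(1,1)] mat_val_zero[of k n n, folded DD]] d by simp
  have hhk: "hk * hk = 0\<^sub>m n n"
    using mat_val_unique[OF mat_val_mult[OF val(2,2)] mat_val_zero[of k n n, folded hh]] d by simp
  have hDhk: "hk * Dk * hk = hk"
  proof -
    have "mat_val_at k (h * D * h) (hk * Dk * hk)" by (intro mat_val_mult val) (use d in auto)
    then show ?thesis unfolding hDh using val mat_val_unique by blast
  qed
  have ipk: "ik * pk = 1\<^sub>m n - Dk * hk - hk * Dk"
  proof -
    have "mat_val_at k (i * p) (ik * pk)" by (intro mat_val_mult val) (use d in auto)
    moreover have "mat_val_at k (i * p) (1\<^sub>m n - Dk * hk - hk * Dk)" unfolding ip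
      by (intro mat_val_diff mat_val_mult mat_val_one val) (use d in auto)
    ultimately show ?thesis by (rule mat_val_unique)
  qed
  have pik: "pk * ik = 1\<^sub>m ?r"
  proof -
    have "mat_val_at k (p * i) (pk * ik)" by (intro mat_val_mult val) (use d in auto)
    then show ?thesis unfolding pi using mat_val_one mat_val_unique by blast
  qed
  have "Dk * hk * Dk = Dk" by (rule contraction_maximal[OF ck DDk hDhk ipk pik])
  then have "Dk * ik = 0\<^sub>m n ?r" by (rule contraction_cycles(1)[OF ck DDk ipk pik])
  moreover have "mat_val_at k (p * D * i) (pk * Dk * ik)" by (intro mat_val_mult val) (use d in auto)
  ultimately show ?thesis using d by (simp add: mat_ring)
qed

text \<open>Both halves of the theorem reduce to this extension; existence follows by feeding in the
  data of \<open>hodge_decomposition\<close>.\<close>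

lemma good_data_extending:
  fixes Q :: "('v::{finite,linorder}) mpoly"
  assumes d_carrier: "d \<in> carrier_mat n n"
    and d_diff: "d * d = 0\<^sub>m n n"
    and d_graded: "\<forall>degC. gr = Some degC \<longrightarrow> homog degC degC 1 d"
    and q_reg: "regular_homology_point Q d q"
    and c0: "h0 \<in> carrier_mat n n" "i0 \<in> carrier_mat n (hom_dim (eval_mat d q))"
      "p0 \<in> carrier_mat (hom_dim (eval_mat d q)) n"
    and cond: "cond_i_at n (eval_mat d q) h0 i0 p0" and gr0: "graded_hip gr degH h0 i0 p0"
  shows "\<exists>h i p d' h'. good_data Q d q n (hom_dim (eval_mat d q)) gr degH h i p d' h' \<and>
           mat_val_at q h h0 \<and> mat_val_at q i i0 \<and> mat_val_at q p p0"
proof -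
  define r where "r = hom_dim (eval_mat d q)"
  define D where "D = map_mat rf d"
  define D0 where "D0 = eval_mat d q"
  note c0 = c0[folded r_def]
  have D: "D \<in> carrier_mat n n" using d_carrier by (simp add: D_def)
  have D0: "D0 \<in> carrier_mat n n" using d_carrier by (simp add: D0_def eval_mat_def)
  have DD: "D * D = 0\<^sub>m n n"
    unfolding D_def using d_carrier by (simp add: rf_mat_mult[symmetric] d_diff) (auto intro!: eq_matI)
  have eval_sq: "eval_mat d k * eval_mat d k = 0\<^sub>m n n" for k
    using d_carrier by (simp add: eval_mat_mult[symmetric] d_diff) (auto simp: eval_mat_def intro!: eq_matI)
  have valD: "mat_val_at k D (eval_mat d k)" for k unfolding D_def by (rule mat_val_rf)
  have c1: "h0 * h0 = 0\<^sub>m n n" "h0 * D0 * h0 = h0" "i0 * p0 = 1\<^sub>m n - D0 * h0 - h0 * D0"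
    "p0 * i0 = 1\<^sub>m r" "D0 * h0 * D0 = D0"
    using cond c0 by (auto simp: cond_i_at_def D0_def)
  obtain h i p v where h: "h \<in> carrier_mat n n" "i \<in> carrier_mat n r" "p \<in> carrier_mat r n"
    "h * h = 0\<^sub>m n n" "h * D * h = h" "i * p = 1\<^sub>m n - D * h - h * D" "p * i = 1\<^sub>m r"
    "mat_val_at q h h0" "mat_val_at q i i0" "mat_val_at q p p0"
    "p * D * i = cmat p0 * ((D - cmat D0) - (D - cmat D0) * h * (D - cmat D0)) * cmat i0"
    "mpeval v q \<noteq> 0"
    "\<forall>k Dk. mpeval v k \<noteq> 0 \<and> mat_val_at k D Dk \<longrightarrow>
       (\<exists>hk ik pk. mat_val_at k h hk \<and> mat_val_at k i ik \<and> mat_val_at k p pk)"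
    "\<forall>degC degH. homog degC degC 1 D \<and> homog degC degC (-1) h0 \<and> homog degC degH 0 i0 \<and>
       homog degH degC 0 p0 \<longrightarrow> homog degC degC (-1) h \<and> homog degC degH 0 i \<and> homog degH degC 0 p"
    using regular_perturbation[OF D DD valD[of q, folded D0_def] c0 c1] .
  note dims = carrier_matD[OF D] carrier_matD[OF h(1)] carrier_matD[OF h(2)] carrier_matD[OF h(3)]
    carrier_matD[OF D0]
  have Qq: "mpeval Q q = 0" using q_reg by (simp add: regular_homology_point_def)
  obtain xi where xi: "mpdir Q q xi \<noteq> 0" "induced_exact D0 (dir_mat d q xi)"
    using q_reg by (auto simp: regular_homology_point_def D0_def)
  have Q0: "rf Q \<noteq> 0"
  proof
    assume "rf Q = 0"
    then have "Q = 0" by simp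
    then have "mpdir Q q xi = 0" by (intro mpdir_eqI) simp
    with xi show False by simp
  qed
  obtain U where U: "zariski_open U" "q \<in> U"
    "\<And>k. k \<in> U \<Longrightarrow> mpeval Q k = 0 \<Longrightarrow> hom_dim (eval_mat d k) = r"
    using q_reg unfolding regular_homology_point_def r_def by blast
  obtain u where u: "mpeval u q \<noteq> 0" "\<And>k. mpeval u k \<noteq> 0 \<Longrightarrow> k \<in> U"
    using zariski_open_basic[OF U(1,2)] by blast
  define T where "T = p * D * i"
  have T: "T \<in> carrier_mat r r" unfolding T_def using h D by (intro mult_carrier_mat) auto
  have T0: "mat_val_at k T (0\<^sub>m r r)" if k: "mpeval Q k = 0" "mpeval (v * u) k \<noteq> 0" for k
  proof -
    have uv: "mpeval v k \<noteq> 0" "mpeval u k \<noteq> 0" using k by auto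
    have r: "hom_dim (eval_mat d k) = r" using U(3)[OF u(2)[OF uv(2)] k(1)] .
    obtain hk ik pk where "mat_val_at k h hk" "mat_val_at k i ik" "mat_val_at k p pk"
      using h(13) uv(1) valD by blast
    from vanishing_on_hypersurface[OF D h(1) _ _ DD h(4,5,6) _ valD this] h r
    show ?thesis by (simp add: T_def)
  qed
  have "\<exists>f c. rval q f c \<and> T $$ (a, b) = rf Q * f" if ab: "a < r" "b < r" for a b
  proof -
    have van: "rval k (T $$ (a, b)) 0" if "mpeval Q k = 0" "mpeval (v * u) k \<noteq> 0" for k
      using T0[OF that] ab T by (auto simp: mat_val_at_def)
    have "mpeval (v * u) q \<noteq> 0" using h(12) u by simp
    \<comment> \<open>\<open>q\<close> itself lies on \<open>Q = 0\<close> and in the neighbourhood,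
      so the vanishing also shows that the entry is regular at \<open>q\<close>.\<close>
    from divisible_if_vanishing[OF Qq xi(1) van[OF Qq this] this van] show ?thesis by metis
  qed
  then obtain f c where fc: "\<And>a b. a < r \<Longrightarrow> b < r \<Longrightarrow> rval q (f a b) (c a b) \<and> T $$ (a, b) = rf Q * f a b"
    by metis
  define d' where "d' = mat r r (\<lambda>(a, b). f a b)"
  define d0 where "d0 = mat r r (\<lambda>(a, b). c a b)"
  have d': "d' \<in> carrier_mat r r" and d0: "d0 \<in> carrier_mat r r" by (simp_all add: d'_def d0_def)
  have vald': "mat_val_at q d' d0" unfolding mat_val_at_def d'_def d0_def using fc by auto
  have Td': "p * D * i = rf Q \<cdot>\<^sub>m d'"
    unfolding T_def[symmetric] by (rule eq_matI) (use fc T in \<open>auto simp: d'_def\<close>)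
  have dd': "d' * d' = 0\<^sub>m r r"
  proof -
    have "rf Q \<cdot>\<^sub>m (rf Q \<cdot>\<^sub>m (d' * d')) = (rf Q \<cdot>\<^sub>m d') * (rf Q \<cdot>\<^sub>m d')" using d' by (simp add: mat_ring)
    also have "\<dots> = 0\<^sub>m r r"
      unfolding Td'[symmetric] by (rule compressed_differential_square[OF D h(1,2,3) DD h(6)])
    finally show ?thesis using d' Q0 by (auto simp: mat_eq_iff simp del: index_mult_mat(1))
  qed
  have dd0: "d0 * d0 = 0\<^sub>m r r"
    using mat_val_unique[OF mat_val_mult[OF vald' vald'] mat_val_zero[of q r r, folded dd']] d' by simp
  define D1 where "D1 = dir_mat d q xi"
  have D1: "D1 \<in> carrier_mat n n" using d_carrier by (simp add: D1_def dir_mat_def)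
  have T1: "mpdir Q q xi \<cdot>\<^sub>m d0 = p0 * D1 * i0"
    unfolding D1_def
    by (rule derivative_of_quotient[OF d_carrier Qq h(1) c0(2,3) d' h(8) vald' refl])
      (use h(11) Td' in \<open>simp add: D_def D0_def\<close>)
  have anti: "D0 * D1 = 0\<^sub>m n n - D1 * D0"
  proof -
    have "dir_mat (d * d) q xi = 0\<^sub>m n n"
    proof -
      have "map_mat cst (0\<^sub>m n n) = (0\<^sub>m n n :: 'v mpoly mat)" by (rule eq_matI) auto
      then show ?thesis unfolding d_diff using dir_mat_cst[of "0\<^sub>m n n" q xi] by simp
    qed
    then have "D1 * D0 + D0 * D1 = 0\<^sub>m n n"
      using dir_mat_mult[of d d q xi] d_carrier by (simp add: D1_def D0_def)
    then show ?thesis using D1 D0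
      by (auto simp: mat_eq_iff add_eq_0_iff simp del: index_mult_mat(1))
  qed
  have smult_vec: "(p0 * D1 * i0) *\<^sub>v x = mpdir Q q xi \<cdot>\<^sub>v (d0 *\<^sub>v x)" if "x \<in> carrier_vec r" for x
    unfolding T1[symmetric] using d0 that by (intro eq_vecI) auto
  have exact: "\<exists>y\<in>carrier_vec r. x = d0 *\<^sub>v y" if x: "x \<in> carrier_vec r" "d0 *\<^sub>v x = 0\<^sub>v r" for x
  proof -
    have "(p0 * D1 * i0) *\<^sub>v x = 0\<^sub>v r" unfolding smult_vec[OF x(1)] x(2) by auto
    from induced_exact_compressed[OF D0 D1 c0 eval_sq[of q, folded D0_def] anti c1(3,4,5) xi(2)[folded D1_def] x(1) this]
    obtain y where y: "y \<in> carrier_vec r" "x = (p0 * D1 * i0) *\<^sub>v y" by (rule bexE)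
    have "x = d0 *\<^sub>v (mpdir Q q xi \<cdot>\<^sub>v y)"
      unfolding y(2) smult_vec[OF y(1)] by (rule mult_mat_vec[OF d0 y(1), symmetric])
    moreover have "mpdir Q q xi \<cdot>\<^sub>v y \<in> carrier_vec r" using y(1) by simp
    ultimately show ?thesis by (rule bexI)
  qed
  obtain h1 where h1: "h1 \<in> carrier_mat r r" "d0 * h1 * d0 = d0" "h1 * d0 * h1 = h1" "h1 * h1 = 0\<^sub>m r r"
    "1\<^sub>m r - d0 * h1 - h1 * d0 = 0\<^sub>m r r" "homog degH degH 1 d0 \<Longrightarrow> homog degH degH (-1) h1"
    using exact_contraction[OF d0 dd0 exact, of degH] by metis
  \<comment> \<open>Exactness of \<open>d0\<close> is a contraction onto the zero space, with empty
    matrices for \<open>i\<close> and \<open>p\<close>. Their size persists under perturbation,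
    which is why \<open>i' * p' = 0\<close> below.\<close>
  have z: "0\<^sub>m r 0 \<in> carrier_mat r 0" "0\<^sub>m 0 r \<in> carrier_mat 0 r" by auto
  have z1: "0\<^sub>m r 0 * 0\<^sub>m 0 r = 1\<^sub>m r - d0 * h1 - h1 * d0" unfolding h1(5) by (rule eq_matI) (auto simp: scalar_prod_def)
  have z2: "0\<^sub>m 0 r * 0\<^sub>m r 0 = 1\<^sub>m 0" by (rule eq_matI) auto
  obtain h' i' p' v' where h': "h' \<in> carrier_mat r r" "i' \<in> carrier_mat r 0" "p' \<in> carrier_mat 0 r"
    "h' * h' = 0\<^sub>m r r" "h' * d' * h' = h'" "i' * p' = 1\<^sub>m r - d' * h' - h' * d'" "p' * i' = 1\<^sub>m 0"
    "mat_val_at q h' h1" "mat_val_at q i' (0\<^sub>m r 0)" "mat_val_at q p' (0\<^sub>m 0 r)"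
    "p' * d' * i' = cmat (0\<^sub>m 0 r) * ((d' - cmat d0) - (d' - cmat d0) * h' * (d' - cmat d0)) * cmat (0\<^sub>m r 0)"
    "mpeval v' q \<noteq> 0"
    "\<forall>k Dk. mpeval v' k \<noteq> 0 \<and> mat_val_at k d' Dk \<longrightarrow>
       (\<exists>hk ik pk. mat_val_at k h' hk \<and> mat_val_at k i' ik \<and> mat_val_at k p' pk)"
    "\<forall>degC degH. homog degC degC 1 d' \<and> homog degC degC (-1) h1 \<and> homog degC degH 0 (0\<^sub>m r 0 :: complex mat) \<and>
       homog degH degC 0 (0\<^sub>m 0 r :: complex mat) \<longrightarrow>
       homog degC degC (-1) h' \<and> homog degC degH 0 i' \<and> homog degH degC 0 p'"
    using regular_perturbation[OF d' dd' vald' h1(1) z h1(4,3) z1 z2 h1(2)] .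
  have hd': "h' * d' + d' * h' = 1\<^sub>m r"
  proof -
    have "i' * p' = 0\<^sub>m r r" using h'(2,3) by (intro eq_matI) (auto simp: scalar_prod_def)
    with h'(6) have "1\<^sub>m r - d' * h' - h' * d' = 0\<^sub>m r r" by simp
    then show ?thesis using d' h'(1)
      by (auto simp: mat_eq_iff algebra_simps simp del: index_mult_mat(1))
  qed
  have gr: "graded_ok gr degH h i p d' h'"
  proof (cases gr)
    case None
    then show ?thesis by (simp add: graded_ok_def graded_hip_def)
  next
    case (Some degC)
    have D_h: "homog degC degC 1 D" unfolding D_def using d_graded Some by (intro homog_map) auto
    have 0: "homog degC degC (-1) h0" "homog degC degH 0 i0" "homog degH degC 0 p0"
      using gr0 Some by (auto simp: graded_hip_def)
    have 1: "homog degC degC (-1) h" "homog degC degH 0 i" "homog degH degC 0 p" using h(14) D_h 0 by blast+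
    have "homog degH degH ((0 + 1) + 0) (p * D * i)"
      by (rule homog_mult[OF homog_mult[OF _ D_h]]) (use 1 dims in auto)
    then have d'1: "homog degH degH 1 d'" unfolding Td' using Q0 by (auto simp: homog_def)
    have "homog degH degH (-1) h'"
    proof -
      have "homog degH degH (-1) h1" by (rule h1(6)[OF homog_mat_val[OF d'1 vald']])
      moreover have "homog degH degH 0 (0\<^sub>m r 0 :: complex mat)" "homog degH degH 0 (0\<^sub>m 0 r :: complex mat)"
        by (auto simp: homog_def)
      ultimately show ?thesis using h'(14) d'1 by blast
    qed
    with 1 d'1 Some show ?thesis by (simp add: graded_ok_def graded_hip_def)
  qed
  have DhD: "mat_val_at q (D * h * D - D) (0\<^sub>m n n)"
  proof -
    have "mat_val_at q (D * h * D - D) (D0 * h0 * D0 - D0)"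
      by (intro mat_val_diff mat_val_mult h(8) valD[of q, folded D0_def]) (use dims in auto)
    moreover have "D0 - D0 = 0\<^sub>m n n" using D0 by (auto intro!: eq_matI)
    ultimately show ?thesis by (simp add: c1)
  qed
  have "good_data Q d q n r gr degH h i p d' h'"
    unfolding good_data_def Let_def D_def[symmetric]
    using h(1-7) d' h'(1,4) dd' hd' Td' gr DhD mat_val_regular[OF h(8)] mat_val_regular[OF h(9)]
      mat_val_regular[OF h(10)] mat_val_regular[OF vald'] mat_val_regular[OF h'(8)]
      total_contraction[OF D h(1-3) d' h'(1) DD h(4-7) Td' Q0 h'(4) hd']
    by blast
  then show ?thesis using h(8,9,10) unfolding r_def by blast
qed

theorem mainTheorem5:
  fixes Q :: "('v::{finite,linorder}) mpoly"
    and d :: "'v mpoly mat"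
    and n :: nat
    and q :: "'v \<Rightarrow> complex"
    and gr :: "(nat \<Rightarrow> int) option"
  assumes d_carrier: "d \<in> carrier_mat n n"
    and d_diff: "d * d = 0\<^sub>m n n"
    and d_graded: "\<forall>degC. gr = Some degC \<longrightarrow> homog degC degC 1 d"
    and Q_irred: "irreducible Q"
    and hom_support: "\<forall>k. hom_dim (eval_mat d k) \<noteq> 0 \<longrightarrow> mpeval Q k = 0"
    and q_reg: "regular_homology_point Q d q"
  shows
    "(\<exists>degH h i p d' h'.
        good_data Q d q n (hom_dim (eval_mat d q)) gr degH h i p d' h') \<and>
     (\<forall>degH h0 i0 p0.
        h0 \<in> carrier_mat n n \<and> i0 \<in> carrier_mat n (hom_dim (eval_mat d q)) \<and>
        p0 \<in> carrier_mat (hom_dim (eval_mat d q)) n \<and>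
        cond_i_at n (eval_mat d q) h0 i0 p0 \<and> graded_hip gr degH h0 i0 p0 \<longrightarrow>
        (\<exists>h i p d' h'.
           good_data Q d q n (hom_dim (eval_mat d q)) gr degH h i p d' h' \<and>
           mat_val_at q h h0 \<and> mat_val_at q i i0 \<and> mat_val_at q p p0))"
proof (intro conjI allI impI)
  let ?D = "eval_mat d q"
  have D: "?D \<in> carrier_mat n n" using d_carrier by (simp add: eval_mat_def)
  have DD: "?D * ?D = 0\<^sub>m n n"
    using d_carrier by (simp add: eval_mat_mult[symmetric] d_diff) (auto simp: eval_mat_def intro!: eq_matI)
  \<comment> \<open>In the ungraded case \<open>graded_hip\<close> asks nothing, so any degree
    function will do; the constant 0 permits one common use of
    \<open>hodge_decomposition\<close>.\<close>
  define degC where "degC = (case gr of None \<Rightarrow> \<lambda>_. 0 | Some degC \<Rightarrow> degC)"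
  obtain degH h i p where hip:
    "h \<in> carrier_mat n n" "i \<in> carrier_mat n (hom_dim ?D)" "p \<in> carrier_mat (hom_dim ?D) n"
    "h * h = 0\<^sub>m n n" "h * ?D * h = h" "i * p = 1\<^sub>m n - ?D * h - h * ?D" "p * i = 1\<^sub>m (hom_dim ?D)" "?D * h * ?D = ?D"
    "homog degC degC 1 ?D \<Longrightarrow> homog degC degC (-1) h \<and> homog degC degH 0 i \<and> homog degH degC 0 p"
    using hodge_decomposition[OF D DD, of degC] by metis
  have "graded_hip gr degH h i p"
  proof (cases gr)
    case None
    then show ?thesis by (simp add: graded_hip_def)
  next
    case (Some deg)
    then have "homog degC degC 1 ?D"
      unfolding eval_mat_def degC_def using d_graded by (intro homog_map) auto
    with hip(9) Some show ?thesis by (simp add: graded_hip_def degC_def)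
  qed
  moreover have "cond_i_at n ?D h i p" using hip by (auto simp: cond_i_at_def)
  ultimately show "\<exists>degH h i p d' h'. good_data Q d q n (hom_dim ?D) gr degH h i p d' h'"
    using good_data_extending[OF d_carrier d_diff d_graded q_reg hip(1,2,3)] by blast
next
  fix degH h0 i0 p0
  assume "h0 \<in> carrier_mat n n \<and> i0 \<in> carrier_mat n (hom_dim (eval_mat d q)) \<and>
        p0 \<in> carrier_mat (hom_dim (eval_mat d q)) n \<and>
        cond_i_at n (eval_mat d q) h0 i0 p0 \<and> graded_hip gr degH h0 i0 p0"
  then show "\<exists>h i p d' h'.
           good_data Q d q n (hom_dim (eval_mat d q)) gr degH h i p d' h' \<and>
           mat_val_at q h h0 \<and> mat_val_at q i i0 \<and> mat_val_at q p p0"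
    using good_data_extending[OF d_carrier d_diff d_graded q_reg] by blast
qed

end
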